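(* Let $\mathcal P$ be a finite chiral polytope of type $\{p_1, \ldots, p_{n-1}\}$. Define $\ell_i = \mathrm{lcm}(p_i, p_{n-i})$ for $i = 1, \ldots, n-1$, and let $\ell = \mathrm{lcm}(\ell_1/p_1, \ldots, \ell_{n-1}/p_{n-1})$. If \[ |\Gamma^+(\mathcal P) \mathbin{\square} \Gamma^+(\overline{\mathcal P})| < \ell \, |\Gamma^+(\mathcal P) \mathbin{\square} \Gamma^+(\mathcal P^{\delta})|, \] then $\mathcal P \diamond \mathcal P^{\delta}$ is chiral.
   Context: An abstract polytope of rank $n$ (an $n$-polytope) is a ranked poset of faces with ranks from $-1$ to $n$, with a unique least face (rank $-1$) and a unique greatest face (rank $n$), in which every flag (maximal chain) has $n+2$ faces, which satisfies the diamond condition (whenever $F<G$ with ranks $j-1$ and $j+1$ there are exactly two $j$-faces strictly between them), and which is strongly flag-connected (any two flags $\Phi,\Psi$ are joined by a sequence of flags, consecutive ones adjacent, all containing $\Phi\cap\Psi$; two flags are adjacent if they differ in exactly one face). $\Phi^j$ denotes the unique flag differing from $\Phi$ only in its $j$-face, and $\Phi^{i,j}=(\Phi^i)^j$. Each polytope considered has a fixed base flag $\Phi$. $\mathcal P$ is chiral if its automorphism group $\Gamma(\mathcal P)$ has exactly two orbits on flags and adjacent flags lie in distinct orbits; then $\Gamma^+(\mathcal P):=\Gamma(\mathcal P)$ is generated by $\sigma_1,\dots,\sigma_{n-1}$, where $\sigma_i$ maps $\Phi$ to $\Phi^{i,i-1}$. One has $(\sigma_i\cdots\sigma_j)^2=1$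 for $i<j$, and the type of $\mathcal P$ is $\{p_1,\dots,p_{n-1}\}$ where $p_i$ is the order of $\sigma_i$. Let $W^+=\langle \sigma_1,\dots,\sigma_{n-1}\mid (\sigma_i\cdots\sigma_j)^2=1 \text{ for } 1\le i<j\le n-1\rangle$. Writing $\Gamma^+(\mathcal P)=W^+/M$ means that $M$ is the kernel of the epimorphism $W^+\to\Gamma^+(\mathcal P)$ preserving the specified generators. For $w\in W^+$, $\overline w$ is obtained by replacing $\sigma_1$ by $\sigma_1^{-1}$, $\sigma_2$ by $\sigma_1^2\sigma_2$ and fixing $\sigma_j$ for $j\ge3$; $\delta(w)$ is obtained by replacing each $\sigma_i$ by $\sigma_{n-i}^{-1}$ (both are automorphisms of $W^+$). Put $\overline M=\{\overline w:w\in M\}$, $\delta(M)=\{\delta(w):w\in M\}$. If $\Gamma^+(\mathcal P)=W^+/M$ with $\mathcal P$ chiral, then $\overline M\ne M$; the mirror image $\overline{\mathcal P}$ (same faces, base flag $\Phi^0$) has $\Gamma^+(\overline{\mathcal P})=W^+/\overline M$, and the dual $\mathcal P^\delta$ (reversed order) has $\Gamma^+(\mathcal P^\delta)=W^+/\delta(M)$. Mix and comix: for groups with specified generators $\Gamma=\langle x_1,\dots,x_k\mid R\rangle$, $\Gamma'=\langle x_1',\dots,x_k'\mid S\rangle$, the mix $\Gamma\diamond\Gamma'$ is the subgroup of $\Gamma\times\Gamma'$ generated by $(x_i,x_i')$, $i=1,\dots,k$, and the comix $\Gamma\mathbin{\square}\Gamma'$ is the group $\langle x_1,x_1',\dots,x_k,x_k'\mid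 R,S,x_1^{-1}x_1',\dots,x_k^{-1}x_k'\rangle$. $\mathcal P\diamond\mathcal Q$ is the flag-connected pre-polytope (polytope axioms with strong flag-connectedness weakened to flag-connectedness) built from $\Gamma^+(\mathcal P)\diamond\Gamma^+(\mathcal Q)$; it is handled through $\Gamma^+(\mathcal P\diamond\mathcal Q)=\Gamma^+(\mathcal P)\diamond\Gamma^+(\mathcal Q)=W^+/N$, and it is directly regular if $\overline N=N$ and chiral if $\overline N\ne N$ (it need not be polytopal). *)

theory Defs
  imports "HOL-Algebra.Group_Action" "HOL-Algebra.Elementary_Groups"
    "HOL-Algebra.Multiplicative_Group"
begin

section \<open>Abstract polytopes with a base flag\<close>

record 'a rooted_poset =
  faces :: "'a set"
  leq :: "'a rel"
  face_rank :: "'a \<Rightarrow> int"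
  base_flag :: "'a set"

definition lt :: "'a rooted_poset \<Rightarrow> 'a \<Rightarrow> 'a \<Rightarrow> bool" where
  "lt P F G \<longleftrightarrow> (F, G) \<in> leq P \<and> F \<noteq> G"

definition flags :: "'a rooted_poset \<Rightarrow> 'a set set" where
  "flags P = {\<Phi> \<in> Chains (leq P). \<forall>C \<in> Chains (leq P). \<Phi> \<subseteq> C \<longrightarrow> C = \<Phi>}"

definition adjacent :: "'a set \<Rightarrow> 'a set \<Rightarrow> bool" where
  "adjacent \<Phi> \<Psi> \<longleftrightarrow> card (\<Phi> - \<Psi>) = 1 \<and> card (\<Psi> - \<Phi>) = 1"

definition diamond_condition :: "'a rooted_poset \<Rightarrow> bool" where
  "diamond_condition P \<longleftrightarrow>
     (\<forall>F G j. lt P F G \<and> face_rank P F = j - 1 \<and> face_rank P G = j + 1 \<longrightarrow>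
        card {H \<in> faces P. face_rank P H = j \<and> lt P F H \<and> lt P H G} = 2)"

definition strongly_flag_connected :: "'a rooted_poset \<Rightarrow> bool" where
  "strongly_flag_connected P \<longleftrightarrow>
     (\<forall>\<Phi> \<in> flags P. \<forall>\<Psi> \<in> flags P.
        (\<Phi>, \<Psi>) \<in> {(A, B). A \<in> flags P \<and> B \<in> flags P \<and> adjacent A B \<and>
                        \<Phi> \<inter> \<Psi> \<subseteq> A \<and> \<Phi> \<inter> \<Psi> \<subseteq> B}\<^sup>*)"

text \<open>The rank function is determined by the order: it is strictly monotone with values in
  \<open>{-1..n}\<close>, and every flag has \<open>n + 2\<close> faces, so every flag has exactly one face of each rank.\<close>

definition polytope :: "nat \<Rightarrow> 'a rooted_poset \<Rightarrow> bool" where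
  "polytope n P \<longleftrightarrow>
     partial_order_on (faces P) (leq P) \<and>
     face_rank P \<in> faces P \<rightarrow> {-1..int n} \<and>
     (\<forall>F G. lt P F G \<longrightarrow> face_rank P F < face_rank P G) \<and>
     (\<exists>!F. F \<in> faces P \<and> face_rank P F = -1 \<and> (\<forall>G \<in> faces P. (F, G) \<in> leq P)) \<and>
     (\<exists>!F. F \<in> faces P \<and> face_rank P F = int n \<and> (\<forall>G \<in> faces P. (G, F) \<in> leq P)) \<and>
     (\<forall>\<Phi> \<in> flags P. card \<Phi> = n + 2) \<and>
     diamond_condition P \<and>
     strongly_flag_connected P \<and>
     base_flag P \<in> flags P"

text \<open>\<open>adj_flag P j \<Phi>\<close> is the flag \<open>\<Phi>\<^sup>j\<close> differing from \<open>\<Phi>\<close> only in its \<open>j\<close>-face.\<close>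

definition adj_flag :: "'a rooted_poset \<Rightarrow> int \<Rightarrow> 'a set \<Rightarrow> 'a set" where
  "adj_flag P j \<Phi> =
     (THE \<Psi>. \<Psi> \<in> flags P \<and> \<Psi> \<noteq> \<Phi> \<and>
        {F \<in> \<Psi>. face_rank P F \<noteq> j} = {F \<in> \<Phi>. face_rank P F \<noteq> j})"

definition mirror_image :: "'a rooted_poset \<Rightarrow> 'a rooted_poset" where
  "mirror_image P = P\<lparr>base_flag := adj_flag P 0 (base_flag P)\<rparr>"

definition dual_polytope :: "nat \<Rightarrow> 'a rooted_poset \<Rightarrow> 'a rooted_poset" where
  "dual_polytope n P = P\<lparr>leq := (leq P)\<inverse>, face_rank := (\<lambda>F. int n - 1 - face_rank P F)\<rparr>"

text \<open>Automorphisms act on the right: the product \<open>\<gamma> \<otimes> \<phi>\<close> is \<open>\<gamma>\<close> followed by \<open>\<phi>\<close>.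
  With \<open>\<sigma>\<^sub>i\<close> sending \<open>\<Phi>\<close> to \<open>(\<Phi>\<^sup>i)\<^sup>i\<^sup>-\<^sup>1\<close>, this is the convention under which the
  relations \<open>(\<sigma>\<^sub>i \<cdots> \<sigma>\<^sub>j)\<^sup>2 = 1\<close> hold.\<close>

definition aut_group :: "'a rooted_poset \<Rightarrow> ('a \<Rightarrow> 'a) monoid" where
  "aut_group P =
     \<lparr>carrier = {\<gamma> \<in> Bij (faces P).
        \<forall>F \<in> faces P. \<forall>G \<in> faces P. (\<gamma> F, \<gamma> G) \<in> leq P \<longleftrightarrow> (F, G) \<in> leq P},
      mult = (\<lambda>\<gamma> \<phi>. compose (faces P) \<phi> \<gamma>),
      one = (\<lambda>F \<in> faces P. F)\<rparr>"

definition chiral_polytope :: "nat \<Rightarrow> 'a rooted_poset \<Rightarrow> bool" where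
  "chiral_polytope n P \<longleftrightarrow>
     polytope n P \<and>
     card (orbits (aut_group P) (flags P) (`)) = 2 \<and>
     (\<forall>\<Phi> \<in> flags P. \<forall>\<Psi> \<in> flags P. adjacent \<Phi> \<Psi> \<longrightarrow>
        orbit (aut_group P) (`) \<Phi> \<noteq> orbit (aut_group P) (`) \<Psi>)"

definition sigma :: "'a rooted_poset \<Rightarrow> nat \<Rightarrow> 'a \<Rightarrow> 'a" where
  "sigma P i =
     (THE \<gamma>. \<gamma> \<in> carrier (aut_group P) \<and>
        \<gamma> ` base_flag P = adj_flag P (int i - 1) (adj_flag P (int i) (base_flag P)))"

definition has_type :: "nat \<Rightarrow> 'a rooted_poset \<Rightarrow> (nat \<Rightarrow> nat) \<Rightarrow> bool" where
  "has_type n P p \<longleftrightarrow> (\<forall>i \<in> {1..<n}. p i = group.ord (aut_group P) (sigma P i))"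


section \<open>Groups given by generators and relators\<close>

text \<open>In a word, the letter \<open>(x, True)\<close> stands for \<open>x\<close> and \<open>(x, False)\<close> for its inverse.\<close>

type_synonym 'x word = "('x \<times> bool) list"

definition words :: "'x set \<Rightarrow> 'x word set" where
  "words X = lists (X \<times> UNIV)"

inductive_set pres_rel :: "'x set \<Rightarrow> 'x word set \<Rightarrow> 'x word rel"
  for X :: "'x set" and R :: "'x word set" where
  refl: "w \<in> words X \<Longrightarrow> (w, w) \<in> pres_rel X R"
| sym: "(u, v) \<in> pres_rel X R \<Longrightarrow> (v, u) \<in> pres_rel X R"
| trans: "(u, v) \<in> pres_rel X R \<Longrightarrow> (v, w) \<in> pres_rel X R \<Longrightarrow> (u, w) \<in> pres_rel X R"
| cong: "(u, v) \<in> pres_rel X R \<Longrightarrow> (u', v') \<in> pres_rel X R \<Longrightarrow> (u @ u', v @ v') \<in> pres_rel X R"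
| cancel: "x \<in> X \<Longrightarrow> ([(x, b), (x, \<not> b)], []) \<in> pres_rel X R"
| relator: "r \<in> R \<Longrightarrow> r \<in> words X \<Longrightarrow> (r, []) \<in> pres_rel X R"

definition pres_group :: "'x set \<Rightarrow> 'x word set \<Rightarrow> 'x word set monoid" where
  "pres_group X R =
     \<lparr>carrier = words X // pres_rel X R,
      mult = (\<lambda>A B. \<Union>u \<in> A. \<Union>v \<in> B. pres_rel X R `` {u @ v}),
      one = pres_rel X R `` {[]}\<rparr>"

definition eval_word :: "('g, 'm) monoid_scheme \<Rightarrow> ('x \<Rightarrow> 'g) \<Rightarrow> 'x word \<Rightarrow> 'g" where
  "eval_word G x w =
     foldr (\<lambda>(i, b) g. (if b then x i else inv\<^bsub>G\<^esub> x i) \<otimes>\<^bsub>G\<^esub> g) w \<one>\<^bsub>G\<^esub>"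

text \<open>The homomorphism from a presented group to \<open>G\<close> taking each generator \<open>i\<close> to \<open>x i\<close>;
  it is well defined when \<open>eval_word G x\<close> is trivial on the relators.\<close>

definition pres_hom :: "('g, 'm) monoid_scheme \<Rightarrow> ('x \<Rightarrow> 'g) \<Rightarrow> 'x word set \<Rightarrow> 'g" where
  "pres_hom G x c = the_elem (eval_word G x ` c)"


section \<open>Mix and comix of groups with specified generators\<close>

type_synonym 'g gen_group = "'g monoid \<times> (nat \<Rightarrow> 'g)"

definition rotation_group :: "'a rooted_poset \<Rightarrow> ('a \<Rightarrow> 'a) gen_group" where
  "rotation_group P = (aut_group P, sigma P)"

definition relators :: "nat set \<Rightarrow> 'g gen_group \<Rightarrow> nat word set" where
  "relators I = (\<lambda>(G, x). {w \<in> words I. eval_word G x w = \<one>\<^bsub>G\<^esub>})"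

definition mix :: "nat set \<Rightarrow> 'g gen_group \<Rightarrow> 'h gen_group \<Rightarrow> ('g \<times> 'h) gen_group" where
  "mix I = (\<lambda>(G, x) (H, y).
     (subgroup_generated (G \<times>\<times> H) ((\<lambda>i. (x i, y i)) ` I), \<lambda>i. (x i, y i)))"

text \<open>Each factor is presented by the set of all its relators; any other set of defining
  relators has the same normal closure and so yields the same group.\<close>

definition comix :: "nat set \<Rightarrow> 'g gen_group \<Rightarrow> 'h gen_group \<Rightarrow> (nat + nat) word set monoid" where
  "comix I A B =
     pres_group (I <+> I)
       (map (apfst Inl) ` relators I A \<union> map (apfst Inr) ` relators I B \<union>
        {[(Inl i, False), (Inr i, True)] | i. i \<in> I})"


section \<open>The group \<open>W\<^sup>+\<close> and chirality\<close>

definition Wplus_relators :: "nat \<Rightarrow> nat word set" where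
  "Wplus_relators n =
     {w @ w | w i j. 1 \<le> i \<and> i < j \<and> j < n \<and> w = map (\<lambda>k. (k, True)) [i..<Suc j]}"

definition Wplus :: "nat \<Rightarrow> nat word set monoid" where
  "Wplus n = pres_group {1..<n} (Wplus_relators n)"

definition Wplus_gen :: "nat \<Rightarrow> nat \<Rightarrow> nat word set" where
  "Wplus_gen n i = pres_rel {1..<n} (Wplus_relators n) `` {[(i, True)]}"

definition Wplus_bar :: "nat \<Rightarrow> nat word set \<Rightarrow> nat word set" where
  "Wplus_bar n =
     pres_hom (Wplus n)
       (\<lambda>i. if i = 1 then inv\<^bsub>Wplus n\<^esub> (Wplus_gen n 1)
            else if i = 2 then (Wplus_gen n 1 [^]\<^bsub>Wplus n\<^esub> (2::nat)) \<otimes>\<^bsub>Wplus n\<^esub> Wplus_gen n 2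
            else Wplus_gen n i)"

text \<open>The subgroup \<open>N\<close> for which the given group with specified generators is \<open>W\<^sup>+/N\<close>.\<close>

definition Wplus_kernel :: "nat \<Rightarrow> 'g gen_group \<Rightarrow> nat word set set" where
  "Wplus_kernel n = (\<lambda>(G, x). kernel (Wplus n) G (pres_hom G x))"

text \<open>The mix of two polytopes is a flag-connected pre-polytope, not necessarily a polytope;
  its chirality is a property of its rotation group \<open>W\<^sup>+/N\<close>, namely that the image of \<open>N\<close>
  under the bar automorphism differs from \<open>N\<close>.\<close>

definition mix_chiral :: "nat \<Rightarrow> 'a rooted_poset \<Rightarrow> 'b rooted_poset \<Rightarrow> bool" where
  "mix_chiral n P Q \<longleftrightarrow>
     (let N = Wplus_kernel n (mix {1..<n} (rotation_group P) (rotation_group Q))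
      in Wplus_bar n ` N \<noteq> N)"

end

theory Submission
  imports Defs
begin

text \<open>Let \<open>x\<close>, \<open>y\<close>, \<open>z\<close> be the distinguished generators of the rotation groups of \<open>\<P>\<close>, of its
  mirror image and of its dual. All three lie in the automorphism group of \<open>\<P>\<close>, where
  \<open>y\<^sub>1 = x\<^sub>1\<^sup>-\<^sup>1\<close>, \<open>y\<^sub>2 = x\<^sub>1\<^sup>2 x\<^sub>2\<close>, \<open>y\<^sub>i = x\<^sub>i\<close> otherwise, and \<open>z\<^sub>i = x\<^bsub>n-i\<^esub>\<^sup>-\<^sup>1\<close>; hence they generate
  the same subgroup \<open>R\<close>. Writing \<open>x(w)\<close> for the value of a word \<open>w\<close>, put
  \<open>S = {y(w) | x(w) = 1}\<close> and \<open>T = {z(w) | x(w) = 1}\<close>. The two comixes are \<open>R / S\<close> and \<open>R / T\<close>.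
  If the mix of \<open>\<P>\<close> with its dual were directly regular, then \<open>x(w) = z(w) = 1\<close> would force
  \<open>y(w) = 1\<close>, so \<open>z(w) \<mapsto> y(w)\<close> would be an epimorphism from \<open>T\<close> onto \<open>S\<close>. As \<open>y\<^sub>i\<close> is \<open>x\<^sub>i\<close> or
  conjugate to \<open>x\<^sub>i\<^sup>-\<^sup>1\<close>, its kernel contains the powers of \<open>z\<^sub>i\<close> with exponent \<open>p\<^sub>i\<close>, which have
  order \<open>\<ell>\<^sub>i / p\<^sub>i\<close>. So \<open>\<ell>\<close> divides the order of the kernel and \<open>\<ell> |S| \<le> |T|\<close>, contradicting the
  inequality between the orders of the comixes.\<close>

section \<open>Words and presented groups\<close>

definition inv_word :: "'x word \<Rightarrow> 'x word" where
  "inv_word w = rev (map (apsnd Not) w)"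

lemma words_Nil [simp]: "[] \<in> words X"
  by (simp add: words_def)

lemma words_Cons [simp]: "a # w \<in> words X \<longleftrightarrow> fst a \<in> X \<and> w \<in> words X"
  by (cases a) (auto simp: words_def)

lemma words_append [simp]: "u @ v \<in> words X \<longleftrightarrow> u \<in> words X \<and> v \<in> words X"
  by (induction u) auto

lemma words_inv_word [simp]: "inv_word w \<in> words X \<longleftrightarrow> w \<in> words X"
  by (induction w) (auto simp: inv_word_def)

section \<open>Evaluation of words in a group\<close>

lemma eval_word_Nil [simp]: "eval_word G x [] = \<one>\<^bsub>G\<^esub>"
  by (simp add: eval_word_def)

lemma eval_word_Cons:
  "eval_word G x (a # w) =
     (if snd a then x (fst a) else inv\<^bsub>G\<^esub> x (fst a)) \<otimes>\<^bsub>G\<^esub> eval_word G x w"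
  by (simp add: eval_word_def case_prod_beta)

lemma eval_word_map_apfst: "eval_word G x (map (apfst f) w) = eval_word G (x \<circ> f) w"
  by (induction w) (auto simp: eval_word_Cons)

lemma eval_word_cong:
  "(\<And>i. i \<in> I \<Longrightarrow> x i = y i) \<Longrightarrow> w \<in> words I \<Longrightarrow> eval_word G x w = eval_word G y w"
  by (induction w) (auto simp: eval_word_Cons)

context group
begin

lemma eval_word_closed [simp]:
  "x \<in> I \<rightarrow> carrier G \<Longrightarrow> w \<in> words I \<Longrightarrow> eval_word G x w \<in> carrier G"
  by (induction w) (auto simp: eval_word_Cons)

lemma eval_word_append:
  "x \<in> I \<rightarrow> carrier G \<Longrightarrow> u \<in> words I \<Longrightarrow> v \<in> words I \<Longrightarrow>
     eval_word G x (u @ v) = eval_word G x u \<otimes> eval_word G x v"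
proof (induction u)
  case (Cons a u)
  then have "x (fst a) \<in> carrier G" by auto
  with Cons show ?case by (auto simp: eval_word_Cons m_assoc)
qed simp

lemma eval_word_inv_word:
  "x \<in> I \<rightarrow> carrier G \<Longrightarrow> w \<in> words I \<Longrightarrow> eval_word G x (inv_word w) = inv (eval_word G x w)"
proof (induction w)
  case (Cons a w)
  then have a: "x (fst a) \<in> carrier G" "fst a \<in> I" by auto
  have "inv_word (a # w) = inv_word w @ [(fst a, \<not> snd a)]"
    by (cases a) (simp add: inv_word_def)
  then have "eval_word G x (inv_word (a # w))
      = eval_word G x (inv_word w) \<otimes> eval_word G x [(fst a, \<not> snd a)]"
    using Cons a by (simp add: eval_word_append[of x I])
  with Cons a show ?case
    by (auto simp: eval_word_Cons inv_mult_group)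
qed (simp add: inv_word_def)

lemma eval_word_power:
  assumes "x i \<in> carrier G"
  shows "eval_word G x (replicate k (i, True)) = x i [^] k"
proof (induction k)
  case (Suc k)
  then show ?case
    using nat_pow_Suc2[OF assms, of k] by (simp add: eval_word_Cons)
qed simp

lemma eval_word_image:
  assumes "x \<in> I \<rightarrow> carrier G"
  shows "eval_word G x ` words I = generate G (x ` I)"
proof
  show "eval_word G x ` words I \<subseteq> generate G (x ` I)"
  proof clarify
    fix w assume "w \<in> words I"
    then show "eval_word G x w \<in> generate G (x ` I)"
      by (induction w) (auto simp: eval_word_Cons intro: generate.intros)
  qed
  show "generate G (x ` I) \<subseteq> eval_word G x ` words I"
  proof
    fix g assume "g \<in> generate G (x ` I)"
    then show "g \<in> eval_word G x ` words I"
    proof induction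
      case one
      show ?case by (rule image_eqI[of _ _ "[]"]) auto
    next
      case (incl h)
      then obtain i where "i \<in> I" "h = x i" by auto
      with assms show ?case
        by (intro image_eqI[of _ _ "[(i, True)]"]) (auto simp: eval_word_Cons Pi_iff)
    next
      case (inv h)
      then obtain i where "i \<in> I" "h = x i" by auto
      with assms show ?case
        by (intro image_eqI[of _ _ "[(i, False)]"]) (auto simp: eval_word_Cons Pi_iff)
    next
      case (eng g h)
      then obtain u v where "u \<in> words I" "v \<in> words I" "g = eval_word G x u" "h = eval_word G x v"
        by auto
      with assms show ?case
        by (intro image_eqI[of _ _ "u @ v"]) (auto simp: eval_word_append)
    qed
  qed
qed

lemma eval_word_subgroup_generated:
  assumes "x \<in> I \<rightarrow> carrier G" "w \<in> words I"
  shows "eval_word (subgroup_generated G (x ` I)) x w = eval_word G x w"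
  using assms(2)
proof (induction w)
  case (Cons a w)
  then have "x (fst a) \<in> carrier (subgroup_generated G (x ` I))"
    using assms(1) by (auto simp: carrier_subgroup_generated intro: generate.incl)
  with Cons show ?case by (auto simp: eval_word_Cons)
qed simp

text \<open>Each rule of the congruence is sound in a group where the relators evaluate to one, so
  induction on the derivation applies. Membership in \<open>words X\<close> is carried along because
  the product rule for evaluation asks for it.\<close>

lemma eval_word_pres_rel:
  assumes x: "x \<in> X \<rightarrow> carrier G"
    and R: "\<And>r. r \<in> R \<Longrightarrow> r \<in> words X \<Longrightarrow> eval_word G x r = \<one>"
    and uv: "(u, v) \<in> pres_rel X R"
  shows "u \<in> words X \<and> v \<in> words X \<and> eval_word G x u = eval_word G x v"
  using uv
proof induction
  case (cancel i b)
  then have "x i \<in> carrier G" using x by auto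
  with cancel show ?case by (auto simp: eval_word_Cons)
qed (auto simp: R eval_word_append[OF x])

end

lemma (in group_hom) eval_word_hom:
  "x \<in> I \<rightarrow> carrier G \<Longrightarrow> w \<in> words I \<Longrightarrow>
     h (eval_word G x w) = eval_word H (h \<circ> x) w"
proof (induction w)
  case (Cons a w)
  then have "x (fst a) \<in> carrier G" by auto
  with Cons show ?case by (auto simp: eval_word_Cons)
qed simp

lemma eval_word_DirProd:
  assumes "group G" "group H" "x \<in> I \<rightarrow> carrier G" "y \<in> I \<rightarrow> carrier H" "w \<in> words I"
  shows "eval_word (G \<times>\<times> H) (\<lambda>i. (x i, y i)) w = (eval_word G x w, eval_word H y w)"
  using assms(5)
proof (induction w)
  case (Cons a w)
  then have "x (fst a) \<in> carrier G" "y (fst a) \<in> carrier H" using assms by auto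
  with Cons assms show ?case by (auto simp: eval_word_Cons inv_DirProd)
qed simp

section \<open>The group of congruence classes of words\<close>

lemma pres_rel_words: "(u, v) \<in> pres_rel X R \<Longrightarrow> u \<in> words X \<and> v \<in> words X"
  by (induction rule: pres_rel.induct) auto

lemma equiv_pres_rel: "equiv (words X) (pres_rel X R)"
proof (rule equivI)
  show "pres_rel X R \<subseteq> words X \<times> words X"
    by (auto dest: pres_rel_words)
  show "refl_on (words X) (pres_rel X R)"
    by (auto simp: refl_on_def intro: pres_rel.refl)
  show "sym (pres_rel X R)"
    by (rule symI) (rule pres_rel.sym)
  show "trans (pres_rel X R)"
    by (rule transI) (rule pres_rel.trans)
qed

lemma pres_rel_class_eq:
  "u \<in> words X \<Longrightarrow> v \<in> words X \<Longrightarrow>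
     pres_rel X R `` {u} = pres_rel X R `` {v} \<longleftrightarrow> (u, v) \<in> pres_rel X R"
  by (rule eq_equiv_class_iff[OF equiv_pres_rel])

text \<open>Cancellation proceeds from the middle outwards. The result supplies the left inverses of
  the presented group.\<close>

lemma pres_rel_inv_word: "w \<in> words X \<Longrightarrow> (inv_word w @ w, []) \<in> pres_rel X R"
proof (induction w)
  case Nil
  show ?case by (simp add: inv_word_def pres_rel.refl)
next
  case (Cons a w)
  obtain i b where a: "a = (i, b)" by (cases a)
  have "([(i, \<not> b), (i, \<not> \<not> b)], []) \<in> pres_rel X R"
    using Cons.prems a by (intro pres_rel.cancel) simp
  then have "([(i, \<not> b), (i, b)] @ w, [] @ w) \<in> pres_rel X R"
    using Cons.prems by (intro pres_rel.cong[OF _ pres_rel.refl]) auto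
  then have "(inv_word w @ ([(i, \<not> b), (i, b)] @ w), inv_word w @ ([] @ w)) \<in> pres_rel X R"
    using Cons.prems by (intro pres_rel.cong[OF pres_rel.refl]) auto
  then show ?case
    using pres_rel.trans[OF _ Cons.IH] Cons.prems a by (simp add: inv_word_def)
qed

text \<open>The product of classes is a union over all pairs of representatives. By
  \<open>pres_rel.cong\<close> all pairs yield the same class, and the given representatives show
  that the union is not empty.\<close>

lemma pres_group_mult:
  assumes "u \<in> words X" "v \<in> words X"
  shows "pres_rel X R `` {u} \<otimes>\<^bsub>pres_group X R\<^esub> pres_rel X R `` {v} = pres_rel X R `` {u @ v}"
proof -
  have "pres_rel X R `` {u' @ v'} = pres_rel X R `` {u @ v}"
    if "u' \<in> pres_rel X R `` {u}" "v' \<in> pres_rel X R `` {v}" for u' v'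
  proof -
    have "(u @ v, u' @ v') \<in> pres_rel X R"
      using that by (intro pres_rel.cong) auto
    then show ?thesis by (simp add: equiv_class_eq[OF equiv_pres_rel])
  qed
  moreover have "u \<in> pres_rel X R `` {u}" "v \<in> pres_rel X R `` {v}"
    using assms by (auto intro: pres_rel.refl)
  ultimately show ?thesis
    unfolding pres_group_def monoid.simps by blast
qed

lemma pres_group_carrierE:
  assumes "A \<in> carrier (pres_group X R)"
  obtains u where "u \<in> words X" "A = pres_rel X R `` {u}"
  using assms by (auto simp: pres_group_def elim: quotientE)

lemma pres_class_closed [simp]:
  "u \<in> words X \<Longrightarrow> pres_rel X R `` {u} \<in> carrier (pres_group X R)"
  by (simp add: pres_group_def quotientI)

lemma pres_group_one: "\<one>\<^bsub>pres_group X R\<^esub> = pres_rel X R `` {[]}"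
  by (simp add: pres_group_def)

lemma group_pres_group: "group (pres_group X R)"
proof (rule groupI)
  fix A B C
  assume A: "A \<in> carrier (pres_group X R)"
  then obtain u where u: "u \<in> words X" "A = pres_rel X R `` {u}" by (rule pres_group_carrierE)
  show "\<one>\<^bsub>pres_group X R\<^esub> \<otimes>\<^bsub>pres_group X R\<^esub> A = A"
    using u by (simp add: pres_group_one pres_group_mult)
  have "pres_rel X R `` {inv_word u} \<otimes>\<^bsub>pres_group X R\<^esub> A = \<one>\<^bsub>pres_group X R\<^esub>"
    using u pres_rel_inv_word[of u X R]
    by (simp add: pres_group_one pres_group_mult pres_rel_class_eq)
  then show "\<exists>B\<in>carrier (pres_group X R). B \<otimes>\<^bsub>pres_group X R\<^esub> A = \<one>\<^bsub>pres_group X R\<^esub>"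
    using u by (intro bexI[of _ "pres_rel X R `` {inv_word u}"]) auto
  assume "B \<in> carrier (pres_group X R)"
  then obtain v where v: "v \<in> words X" "B = pres_rel X R `` {v}" by (rule pres_group_carrierE)
  show "A \<otimes>\<^bsub>pres_group X R\<^esub> B \<in> carrier (pres_group X R)"
    using u v by (simp add: pres_group_mult)
  assume "C \<in> carrier (pres_group X R)"
  then obtain w where w: "w \<in> words X" "C = pres_rel X R `` {w}" by (rule pres_group_carrierE)
  show "A \<otimes>\<^bsub>pres_group X R\<^esub> B \<otimes>\<^bsub>pres_group X R\<^esub> C
      = A \<otimes>\<^bsub>pres_group X R\<^esub> (B \<otimes>\<^bsub>pres_group X R\<^esub> C)"
    using u v w by (simp add: pres_group_mult)
qed (simp add: pres_group_one)

text \<open>Only a negative letter calls for an argument: by cancellation its class is a left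
  inverse of the class of the generator. The lemma turns calculations with classes into group
  calculations with generators.\<close>

lemma eval_word_pres_group:
  assumes "w \<in> words X"
  shows "eval_word (pres_group X R) (\<lambda>i. pres_rel X R `` {[(i, True)]}) w = pres_rel X R `` {w}"
  using assms
proof (induction w)
  case Nil
  show ?case by (simp add: pres_group_one)
next
  case (Cons a w)
  interpret W: group "pres_group X R" by (rule group_pres_group)
  obtain i b where a: "a = (i, b)" by (cases a)
  have i: "i \<in> X" using Cons.prems a by simp
  have "([(i, False), (i, \<not> False)], []) \<in> pres_rel X R"
    using i by (rule pres_rel.cancel)
  then have "pres_rel X R `` {[(i, False)]} \<otimes>\<^bsub>pres_group X R\<^esub> pres_rel X R `` {[(i, True)]}
      = \<one>\<^bsub>pres_group X R\<^esub>"
    using i by (simp add: pres_group_mult pres_group_one pres_rel_class_eq)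
  then have "inv\<^bsub>pres_group X R\<^esub> (pres_rel X R `` {[(i, True)]}) = pres_rel X R `` {[(i, False)]}"
    using i by (intro W.inv_equality) auto
  with Cons a show ?case by (auto simp: eval_word_Cons pres_group_mult)
qed

lemma eval_word_relator:
  assumes "r \<in> R" "r \<in> words X"
  shows "eval_word (pres_group X R) (\<lambda>i. pres_rel X R `` {[(i, True)]}) r = \<one>\<^bsub>pres_group X R\<^esub>"
  using assms pres_rel.relator[of r R X]
  by (simp add: eval_word_pres_group pres_group_one pres_rel_class_eq)

section \<open>Von Dyck's theorem: homomorphisms out of a presented group\<close>

context group
begin

context
  fixes x X R
  assumes x: "x \<in> X \<rightarrow> carrier G"
    and R: "\<And>r. r \<in> R \<Longrightarrow> r \<in> words X \<Longrightarrow> eval_word G x r = \<one>"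
begin

text \<open>Evaluation is constant on each class by soundness of the congruence, so
  \<open>the_elem\<close> is applied to a singleton.\<close>

lemma pres_hom_class:
  assumes "u \<in> words X"
  shows "pres_hom G x (pres_rel X R `` {u}) = eval_word G x u"
proof -
  have "eval_word G x v = eval_word G x u" if "v \<in> pres_rel X R `` {u}" for v
    using eval_word_pres_rel[OF x R, where u = u and v = v] that by auto
  moreover have "u \<in> pres_rel X R `` {u}"
    using assms by (auto intro: pres_rel.refl)
  ultimately have "eval_word G x ` (pres_rel X R `` {u}) = {eval_word G x u}"
    by blast
  then show ?thesis by (simp add: pres_hom_def)
qed

lemma group_hom_pres_hom: "group_hom (pres_group X R) G (pres_hom G x)"
proof -
  have "pres_hom G x \<in> hom (pres_group X R) G"
  proof (rule homI)
    fix A B assume "A \<in> carrier (pres_group X R)"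
    then obtain u where u: "u \<in> words X" "A = pres_rel X R `` {u}" by (rule pres_group_carrierE)
    then show "pres_hom G x A \<in> carrier G"
      using x by (simp add: pres_hom_class)
    assume "B \<in> carrier (pres_group X R)"
    then obtain v where v: "v \<in> words X" "B = pres_rel X R `` {v}" by (rule pres_group_carrierE)
    with u show "pres_hom G x (A \<otimes>\<^bsub>pres_group X R\<^esub> B) = pres_hom G x A \<otimes> pres_hom G x B"
      by (simp add: pres_hom_class pres_group_mult eval_word_append[OF x])
  qed
  then show ?thesis
    by (simp add: group_hom_def group_hom_axioms_def group_pres_group is_group)
qed

end

end

section \<open>The order of the comix\<close>

text \<open>The kernel of the projection from the group generated by \<open>y\<close> onto the comix of \<open>x\<close> and \<open>y\<close>.\<close>

definition relator_values ::
    "nat set \<Rightarrow> ('g, 'm) monoid_scheme \<Rightarrow> (nat \<Rightarrow> 'g) \<Rightarrow> (nat \<Rightarrow> 'g) \<Rightarrow> 'g set" where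
  "relator_values I G x y = {eval_word G y w | w. w \<in> words I \<and> eval_word G x w = \<one>\<^bsub>G\<^esub>}"

context group
begin

context
  fixes I :: "nat set" and x y :: "nat \<Rightarrow> 'a"
  assumes x: "x \<in> I \<rightarrow> carrier G" and y: "y \<in> I \<rightarrow> carrier G"
begin

lemma subgroup_relator_values: "subgroup (relator_values I G x y) G"
proof (rule subgroupI)
  show "relator_values I G x y \<subseteq> carrier G"
    using y by (auto simp: relator_values_def)
  have "[] \<in> words I \<and> eval_word G x [] = \<one>" by simp
  then show "relator_values I G x y \<noteq> {}"
    unfolding relator_values_def by blast
next
  fix a assume "a \<in> relator_values I G x y"
  then obtain w where "w \<in> words I" "eval_word G x w = \<one>" "a = eval_word G y w"
    by (auto simp: relator_values_def)
  then show "inv a \<in> relator_values I G x y"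
    unfolding relator_values_def
    by (intro CollectI exI[of _ "inv_word w"]) (simp add: eval_word_inv_word[OF x] eval_word_inv_word[OF y])
next
  fix a b assume "a \<in> relator_values I G x y" "b \<in> relator_values I G x y"
  then obtain v w where "v \<in> words I" "eval_word G x v = \<one>" "a = eval_word G y v"
    "w \<in> words I" "eval_word G x w = \<one>" "b = eval_word G y w"
    by (auto simp: relator_values_def)
  then show "a \<otimes> b \<in> relator_values I G x y"
    unfolding relator_values_def
    by (intro CollectI exI[of _ "v @ w"]) (simp add: eval_word_append[OF x] eval_word_append[OF y])
qed

text \<open>The conjugate of y(w) by y(u) is the value of u w u^-1, and \<open>x\<close> sends this
  word to one if it sends w to one. The conjugating element has to be the value of a word, which is
  why the ambient group is the one generated by \<open>y\<close>.\<close>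

lemma normal_relator_values:
  "relator_values I G x y \<lhd> subgroup_generated G (y ` I)"
proof -
  let ?H = "subgroup_generated G (y ` I)"
  have H: "carrier ?H = eval_word G y ` words I"
    using y by (simp add: eval_word_image carrier_subgroup_generated Int_absorb1 image_subset_iff_funcset)
  have "relator_values I G x y \<subseteq> carrier ?H"
    unfolding H by (auto simp: relator_values_def)
  then have sub: "subgroup (relator_values I G x y) ?H"
    using subgroup_relator_values by (simp add: subgroup_subgroup_generated_iff)
  interpret H: group ?H by simp
  show ?thesis
    unfolding H.normal_inv_iff
  proof (intro conjI ballI sub)
    fix g h assume g: "g \<in> carrier ?H" and h: "h \<in> relator_values I G x y"
    obtain u where u: "u \<in> words I" "g = eval_word G y u" using g H by auto
    obtain w where w: "w \<in> words I" "eval_word G x w = \<one>" "h = eval_word G y w"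
      using h by (auto simp: relator_values_def)
    have "g \<otimes> h \<otimes> inv g = eval_word G y (u @ w @ inv_word u)"
      using u w y by (simp add: eval_word_append[OF y] eval_word_inv_word[OF y] m_assoc)
    moreover have "eval_word G x (u @ w @ inv_word u) = \<one>"
      using u w x by (simp add: eval_word_append[OF x] eval_word_inv_word[OF x])
    ultimately have "g \<otimes> h \<otimes> inv g \<in> relator_values I G x y"
      using u w unfolding relator_values_def by (intro CollectI exI[of _ "u @ w @ inv_word u"]) auto
    with g show "g \<otimes>\<^bsub>?H\<^esub> h \<otimes>\<^bsub>?H\<^esub> inv\<^bsub>?H\<^esub> g \<in> relator_values I G x y" by simp
  qed
qed

end

end

text \<open>Let \<open>H\<close> be the group generated by \<open>y\<close> and \<open>S\<close> the
  set of relator values. Sending both copies of the generator i to the coset of \<open>y i\<close>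
  gives an isomorphism from the comix onto \<open>H Mod S\<close>, and Lagrange's theorem yields the
  product formula.\<close>

lemma order_comix:
  fixes G (structure) and I :: "nat set"
  assumes "group G" and x: "x \<in> I \<rightarrow> carrier G" and y: "y \<in> I \<rightarrow> carrier G"
  shows "order (comix I (G, x) (G, y)) * card (relator_values I G x y) = card (generate G (y ` I))"
proof -
  interpret group G by fact
  define S where "S = relator_values I G x y"
  define H where "H = subgroup_generated G (y ` I)"
  define X where "X = I <+> I"
  define R where "R = map (apfst Inl) ` relators I (G, x) \<union> map (apfst Inr) ` relators I (G, y) \<union>
        {[(Inl i, False), (Inr i, True)] | i. i \<in> I}"
  \<comment> \<open>\<open>c\<close> merges the two copies of the index set; \<open>q\<close>
    assigns to either copy of i the coset of \<open>y i\<close>.\<close>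
  define c :: "nat + nat \<Rightarrow> nat" where "c = case_sum id id"
  define q where "q = (\<lambda>j. S #>\<^bsub>H\<^esub> y (c j))"
  have cH: "carrier H = generate G (y ` I)"
    unfolding H_def using y by (simp add: carrier_subgroup_generated Int_absorb1 image_subset_iff_funcset)
  interpret H: group H unfolding H_def by simp
  interpret N: normal S H unfolding S_def H_def by (rule normal_relator_values[OF x y])
  interpret Q: group "H Mod S" by (rule N.factorgroup_is_group)
  interpret r: group_hom H "H Mod S" "\<lambda>a. S #>\<^bsub>H\<^esub> a"
    using N.r_coset_hom_Mod by unfold_locales
  have yH: "y \<in> I \<rightarrow> carrier H"
    unfolding cH by (auto intro: generate.incl)
  have cX: "c \<in> X \<rightarrow> I" by (auto simp: c_def X_def)
  have evH: "eval_word H y w = eval_word G y w" if "w \<in> words I" for w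
    using eval_word_subgroup_generated[OF y that] by (simp add: H_def)
  have evq: "eval_word (H Mod S) q w = S #>\<^bsub>H\<^esub> eval_word G y (map (apfst c) w)"
    if w: "w \<in> words X" for w
  proof -
    have cw: "map (apfst c) w \<in> words I"
      using w cX by (induction w) auto
    have "S #>\<^bsub>H\<^esub> eval_word G y (map (apfst c) w) = S #>\<^bsub>H\<^esub> eval_word H y (map (apfst c) w)"
      by (simp add: evH cw)
    also have "\<dots> = eval_word (H Mod S) ((\<lambda>a. S #>\<^bsub>H\<^esub> a) \<circ> y) (map (apfst c) w)"
      by (rule r.eval_word_hom[OF yH cw])
    also have "\<dots> = eval_word (H Mod S) q w"
      by (simp add: eval_word_map_apfst q_def o_def)
    finally show ?thesis by simp
  qed
  have q: "q \<in> X \<rightarrow> carrier (H Mod S)"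
    unfolding q_def using cX yH by (intro funcsetI r.hom_closed) blast
  have cInl: "map (apfst c) (map (apfst Inl) w) = w" and cInr: "map (apfst c) (map (apfst Inr) w) = w" for w
    by (induction w) (auto simp: c_def)
  have wX: "map (apfst Inl) w \<in> words X" "map (apfst Inr) w \<in> words X" if "w \<in> words I" for w
    using that by (induction w) (auto simp: X_def)
  have rel: "eval_word (H Mod S) q r = \<one>\<^bsub>H Mod S\<^esub>" if r: "r \<in> R" "r \<in> words X" for r
  proof -
    \<comment> \<open>Relators of \<open>x\<close> have values in \<open>S\<close> by the definition
      of \<open>S\<close>, relators of \<open>y\<close> have value one, and the identifying relators
      become y_i^-1 y_i.\<close>
    consider w where "w \<in> words I" "eval_word G x w = \<one>" "r = map (apfst Inl) w"
      | w where "w \<in> words I" "eval_word G y w = \<one>" "r = map (apfst Inr) w"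
      | i where "i \<in> I" "r = [(Inl i, False), (Inr i, True)]"
      using r(1) by (auto simp: R_def relators_def)
    then have "eval_word G y (map (apfst c) r) \<in> S"
    proof cases
      case 1
      then show ?thesis by (auto simp: cInl S_def relator_values_def simp del: map_map)
    next
      case 2
      then show ?thesis
        using N.one_closed by (simp add: cInr H_def del: map_map)
    next
      case 3
      moreover have "y i \<in> carrier G" using y 3 by auto
      ultimately show ?thesis using N.one_closed by (simp add: c_def eval_word_Cons H_def)
    qed
    then show ?thesis
      using r(2) N.rcos_const by (simp add: evq)
  qed
  let ?W = "pres_group X R"
  interpret W: group ?W by (rule group_pres_group)
  interpret h: group_hom ?W "H Mod S" "pres_hom (H Mod S) q"
    by (rule Q.group_hom_pres_hom[OF q rel])
  \<comment> \<open>In the comix a word equals its copy moved wholly to the second set of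
    generators, because the identifying relators equate \<open>Inl i\<close> with
    \<open>Inr i\<close>.\<close>
  have Inr_class: "pres_rel X R `` {map (apfst Inr) w} = pres_rel X R `` {w'}"
    if "w = map (apfst c) w'" "w' \<in> words X" for w w'
  proof -
    have "(map (apfst Inr) (map (apfst c) w'), w') \<in> pres_rel X R"
      using that(2)
    proof (induction w')
      case Nil
      show ?case by (simp add: pres_rel.refl)
    next
      case (Cons a u)
      obtain j b where a: "a = (j, b)" by (cases a)
      have "([(Inr (c j), b)], [(j, b)]) \<in> pres_rel X R"
      proof (cases j)
        case (Inr i)
        with Cons a show ?thesis by (auto simp: c_def intro: pres_rel.refl)
      next
        case (Inl i)
        have i: "i \<in> I" "Inl i \<in> X" "Inr i \<in> X" using Cons a Inl by (auto simp: X_def)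
        let ?l = "pres_rel X R `` {[(Inl i, True)]}" and ?r = "pres_rel X R `` {[(Inr i, True)]}"
        let ?g = "\<lambda>j. pres_rel X R `` {[(j, True)]}"
        have lr: "?l \<in> carrier ?W" "?r \<in> carrier ?W" using i by auto
        have "eval_word ?W ?g [(Inl i, False), (Inr i, True)] = \<one>\<^bsub>?W\<^esub>"
          using i by (intro eval_word_relator) (auto simp: R_def)
        then have "inv\<^bsub>?W\<^esub> ?l \<otimes>\<^bsub>?W\<^esub> ?r = \<one>\<^bsub>?W\<^esub>"
          using lr by (simp add: eval_word_Cons)
        then have "?l \<otimes>\<^bsub>?W\<^esub> (inv\<^bsub>?W\<^esub> ?l \<otimes>\<^bsub>?W\<^esub> ?r) = ?l"
          using lr by simp
        then have "?r = ?l"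
          using lr by (simp add: W.m_assoc[symmetric])
        then have "eval_word ?W ?g [(Inr i, b)] = eval_word ?W ?g [(Inl i, b)]"
          by (simp add: eval_word_Cons)
        then show ?thesis
          using i Inl by (simp add: eval_word_pres_group pres_rel_class_eq c_def)
      qed
      moreover have "(map (apfst Inr) (map (apfst c) u), u) \<in> pres_rel X R"
        using Cons by simp
      ultimately show ?case
        using a pres_rel.cong[of "[(Inr (c j), b)]" "[(j, b)]" X R] by (auto simp: c_def)
    qed
    then show ?thesis using that(1) by (simp add: equiv_class_eq[OF equiv_pres_rel])
  qed
  \<comment> \<open>Let \<open>v\<close> be the merged form of a word in the kernel. Then y(v) =
    y(w) for some relator \<open>w\<close> of \<open>x\<close>. In the comix w is trivial through
    the first copy and w^-1 v through the second, hence v is trivial too.\<close>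
  have "inj_on (pres_hom (H Mod S) q) (carrier ?W)"
    unfolding h.inj_on_one_iff
  proof (intro allI impI)
    fix A assume A: "A \<in> carrier ?W" "pres_hom (H Mod S) q A = \<one>\<^bsub>H Mod S\<^esub>"
    then obtain u where u: "u \<in> words X" "A = pres_rel X R `` {u}"
      by (elim pres_group_carrierE)
    define v where "v = map (apfst c) u"
    have v: "v \<in> words I" unfolding v_def using u(1) cX by (induction u) auto
    have yv: "eval_word G y v \<in> carrier H"
      using H.eval_word_closed[OF yH v] by (simp add: evH v)
    have "S #>\<^bsub>H\<^esub> eval_word G y v = S"
      using A(2) u by (simp add: Q.pres_hom_class[OF q rel] evq v_def)
    then have "eval_word G y v \<in> S"
      using H.rcos_self[OF yv N.subgroup_axioms] by simp
    then obtain w where w: "w \<in> words I" "eval_word G x w = \<one>" "eval_word G y w = eval_word G y v"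
      unfolding S_def relator_values_def by auto
    have 1: "pres_rel X R `` {map (apfst Inl) w} = \<one>\<^bsub>?W\<^esub>"
      unfolding pres_group_one using w wX
      by (subst pres_rel_class_eq) (auto simp: R_def relators_def intro!: pres_rel.relator)
    have 2: "pres_rel X R `` {map (apfst Inr) (inv_word w @ v)} = \<one>\<^bsub>?W\<^esub>"
      unfolding pres_group_one
    proof (subst pres_rel_class_eq)
      have "eval_word G y (inv_word w @ v) = \<one>"
        using w v y by (simp add: eval_word_append[OF y] eval_word_inv_word[OF y])
      then have "inv_word w @ v \<in> relators I (G, y)"
        using w v by (simp add: relators_def)
      then have "map (apfst Inr) (inv_word w @ v) \<in> R"
        unfolding R_def by blast
      then show "(map (apfst Inr) (inv_word w @ v), []) \<in> pres_rel X R"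
        using w v by (intro pres_rel.relator wX) simp_all
    qed (use w v wX in auto)
    \<comment> \<open>The triviality of \<open>w\<close>, known in the first copy, is carried over
      to the second copy, where w^-1 v lives.\<close>
    have "pres_rel X R `` {map (apfst Inr) w} = \<one>\<^bsub>?W\<^esub>"
      using Inr_class[OF cInl[symmetric] wX(1)[OF w(1)]] 1 by simp
    moreover have "pres_rel X R `` {map (apfst Inr) (inv_word w @ v)}
        = inv\<^bsub>?W\<^esub> (pres_rel X R `` {map (apfst Inr) w}) \<otimes>\<^bsub>?W\<^esub> pres_rel X R `` {map (apfst Inr) v}"
    proof -
      \<comment> \<open>Evaluation at the second copy of the generators turns concatenation and
        formal inverse into the operations of the comix.\<close>
      define g where "g = (\<lambda>i. pres_rel X R `` {[(Inr i :: nat + nat, True)]})"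
      have g: "g \<in> I \<rightarrow> carrier ?W"
        unfolding g_def by (intro funcsetI pres_class_closed) (simp add: X_def InrI)
      have "eval_word ?W g t = pres_rel X R `` {map (apfst Inr) t}" if "t \<in> words I" for t
        using eval_word_pres_group[OF wX(2)[OF that], of R]
        by (simp add: eval_word_map_apfst g_def o_def)
      then show ?thesis
        using W.eval_word_append[OF g, of "inv_word w" v] W.eval_word_inv_word[OF g, of w] w v by simp
    qed
    ultimately have "pres_rel X R `` {map (apfst Inr) v} = \<one>\<^bsub>?W\<^esub>"
      using 2 wX v by simp
    then show "A = \<one>\<^bsub>?W\<^esub>"
      using Inr_class[of v u] u v_def by simp
  qed
  moreover have "pres_hom (H Mod S) q ` carrier ?W = carrier (H Mod S)"
  proof
    show "carrier (H Mod S) \<subseteq> pres_hom (H Mod S) q ` carrier ?W"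
    proof
      fix C assume "C \<in> carrier (H Mod S)"
      then obtain a where a: "a \<in> carrier H" "C = S #>\<^bsub>H\<^esub> a"
        by (auto simp: FactGroup_def RCOSETS_def)
      then obtain w where w: "w \<in> words I" "a = eval_word G y w"
        using cH eval_word_image[OF y] by auto
      then have "C = pres_hom (H Mod S) q (pres_rel X R `` {map (apfst Inr) w})"
        using a wX by (simp add: Q.pres_hom_class[OF q rel] evq cInr del: map_map)
      then show "C \<in> pres_hom (H Mod S) q ` carrier ?W"
        using w wX by auto
    qed
  qed auto
  ultimately have "card (carrier ?W) = card (carrier (H Mod S))"
    by (metis card_image)
  then have "order ?W * card S = order H"
    using H.lagrange[OF N.subgroup_axioms] by (simp add: order_def FactGroup_def)
  moreover have "?W = comix I (G, x) (G, y)"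
    by (simp add: comix_def X_def R_def)
  ultimately show ?thesis
    by (simp add: S_def order_def cH)
qed

section \<open>Lagrange's theorem and the comparison of two sets of relator values\<close>

lemma (in group) ord_dvd_card_subgroup:
  assumes "subgroup K G" "a \<in> K"
  shows "ord a dvd card K"
proof -
  interpret K: group "G\<lparr>carrier := K\<rparr>"
    using assms(1) by (rule subgroup_imp_group)
  have "a [^]\<^bsub>G\<lparr>carrier := K\<rparr>\<^esub> card K = \<one>"
    using K.pow_order_eq_1[of a] assms(2) by (simp add: order_def)
  then have "a [^] card K = \<one>"
    by (simp add: nat_pow_consistent[symmetric])
  then show ?thesis
    using assms by (simp add: pow_eq_id subgroup.mem_carrier)
qed

text \<open>The first isomorphism theorem for the map onto its image, combined with Lagrange's
  theorem for the kernel.\<close>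

lemma (in group_hom) card_image_mult_card_kernel:
  "card (h ` carrier G) * card (kernel G H h) = order G"
proof -
  interpret K: group_hom G "H\<lparr>carrier := h ` carrier G\<rparr>" h
  proof (rule group_hom.intro)
    show "group (H\<lparr>carrier := h ` carrier G\<rparr>)"
      using img_is_subgroup by (rule H.subgroup_imp_group)
    show "group_hom_axioms G (H\<lparr>carrier := h ` carrier G\<rparr>) h"
      by (auto simp: group_hom_axioms_def hom_def)
  qed (rule G.group_axioms)
  have ker: "kernel G (H\<lparr>carrier := h ` carrier G\<rparr>) h = kernel G H h"
    by (simp add: kernel_def)
  have "(\<lambda>X. the_elem (h ` X)) \<in> iso (G Mod kernel G H h) (H\<lparr>carrier := h ` carrier G\<rparr>)"
    using K.FactGroup_iso_set by (simp add: ker)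
  then have "card (rcosets\<^bsub>G\<^esub> kernel G H h) = card (h ` carrier G)"
    by (auto simp: iso_def FactGroup_def dest: bij_betw_same_card)
  with G.lagrange[OF subgroup_kernel] show ?thesis by simp
qed

text \<open>By \<open>xzy\<close> the assignment z(w) to y(w), for relators w of \<open>x\<close>,
  is a well defined epimorphism between the two sets of values. The words provided by
  \<open>d\<close> give kernel elements of order \<open>d i\<close>, so the least common multiple of
  these orders divides the order of the kernel.\<close>

lemma (in group) card_relator_values_mono:
  assumes fin: "finite (carrier G)"
    and x: "x \<in> I \<rightarrow> carrier G" and y: "y \<in> I \<rightarrow> carrier G" and z: "z \<in> I \<rightarrow> carrier G"
    and xzy: "\<And>w. w \<in> words I \<Longrightarrow> eval_word G x w = \<one> \<Longrightarrow> eval_word G z w = \<one>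
        \<Longrightarrow> eval_word G y w = \<one>"
    and d: "\<And>i. i \<in> J \<Longrightarrow> \<exists>w \<in> words I. eval_word G x w = \<one> \<and> eval_word G y w = \<one> \<and>
        ord (eval_word G z w) = d i"
  shows "Lcm (d ` J) * card (relator_values I G x y) \<le> card (relator_values I G x z)"
proof -
  define S where "S = relator_values I G x y"
  define T where "T = relator_values I G x z"
  \<comment> \<open>Some relator of \<open>x\<close> with value t under \<open>z\<close> is chosen;
    the fact \<open>f\<close> below shows that the choice does not matter.\<close>
  define f where "f t = eval_word G y (SOME w. w \<in> words I \<and> eval_word G x w = \<one> \<and> eval_word G z w = t)" for t
  have T: "subgroup T G"
    unfolding T_def by (rule subgroup_relator_values[OF x z])
  have TE: "\<exists>w. w \<in> words I \<and> eval_word G x w = \<one> \<and> eval_word G z w = t" if "t \<in> T" for t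
    using that by (auto simp: T_def relator_values_def)
  have f: "f (eval_word G z w) = eval_word G y w" if w: "w \<in> words I" "eval_word G x w = \<one>" for w
  proof -
    define v where "v = (SOME v. v \<in> words I \<and> eval_word G x v = \<one> \<and> eval_word G z v = eval_word G z w)"
    have v: "v \<in> words I" "eval_word G x v = \<one>" "eval_word G z v = eval_word G z w"
      using someI[of "\<lambda>v. v \<in> words I \<and> eval_word G x v = \<one> \<and> eval_word G z v = eval_word G z w" w] w
      by (auto simp: v_def)
    \<comment> \<open>Since \<open>v\<close> and \<open>w\<close> agree under \<open>x\<close> and
      under \<open>z\<close>, both send v^-1 w to one, and hence so does \<open>y\<close>.\<close>
    have "eval_word G y (inv_word v @ w) = \<one>"
      using v w x z
      by (intro xzy) (simp_all add: eval_word_append[OF x] eval_word_inv_word[OF x]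
          eval_word_append[OF z] eval_word_inv_word[OF z])
    then have "inv (eval_word G y v) \<otimes> eval_word G y w = \<one>"
      using v w by (simp add: eval_word_append[OF y] eval_word_inv_word[OF y])
    then have "eval_word G y v = eval_word G y w"
      using v w y eval_word_closed[OF y v(1)] eval_word_closed[OF y w(1)]
      by (metis inv_equality inv_inv inv_closed)
    then show ?thesis by (simp add: f_def v_def)
  qed
  interpret h: group_hom "G\<lparr>carrier := T\<rparr>" G f
  proof (rule group_hom.intro)
    show "group (G\<lparr>carrier := T\<rparr>)" using T by (rule subgroup_imp_group)
    have "f \<in> hom (G\<lparr>carrier := T\<rparr>) G"
    proof (rule homI)
      fix s t assume "s \<in> carrier (G\<lparr>carrier := T\<rparr>)"
      then obtain u where u: "u \<in> words I" "eval_word G x u = \<one>" "s = eval_word G z u"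
        using TE[of s] by auto
      show "f s \<in> carrier G" using u y by (simp add: f)
      assume "t \<in> carrier (G\<lparr>carrier := T\<rparr>)"
      then obtain v where v: "v \<in> words I" "eval_word G x v = \<one>" "t = eval_word G z v"
        using TE[of t] by auto
      have "f (eval_word G z (u @ v)) = eval_word G y (u @ v)"
        using u v by (intro f) (simp_all add: eval_word_append[OF x])
      then show "f (s \<otimes>\<^bsub>G\<lparr>carrier := T\<rparr>\<^esub> t) = f s \<otimes> f t"
        using u v by (simp add: f eval_word_append[OF y] eval_word_append[OF z])
    qed
    then show "group_hom_axioms (G\<lparr>carrier := T\<rparr>) G f" by (rule group_hom_axioms.intro)
  qed (rule group_axioms)
  define K where "K = kernel (G\<lparr>carrier := T\<rparr>) G f"
  have K: "subgroup K G"
    unfolding K_def using T h.subgroup_kernel by (rule incl_subgroup)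
  have "f ` T = S"
    unfolding T_def S_def relator_values_def by (auto simp: f image_iff) (metis f)
  then have TSK: "card T = card S * card K"
    using h.card_image_mult_card_kernel by (simp add: K_def order_def)
  have "Lcm (d ` J) dvd card K"
  proof (rule Lcm_least)
    fix e assume "e \<in> d ` J"
    then obtain w where w: "w \<in> words I" "eval_word G x w = \<one>" "eval_word G y w = \<one>"
        "ord (eval_word G z w) = e"
      using d by blast
    have "eval_word G z w \<in> T"
      using w by (auto simp: T_def relator_values_def)
    then have "eval_word G z w \<in> K"
      using w by (simp add: K_def kernel_def f)
    then show "e dvd card K"
      using ord_dvd_card_subgroup[OF K] w(4) by blast
  qed
  \<comment> \<open>Finiteness enters here: divisibility gives an upper bound because the
    cardinality of \<open>K\<close> is not zero.\<close>
  moreover have "card K > 0"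
    using K fin by (rule subgroup.finite_imp_card_positive)
  ultimately have "Lcm (d ` J) \<le> card K"
    by (simp add: dvd_imp_le)
  then show ?thesis
    using TSK by (simp add: S_def T_def mult.commute)
qed

section \<open>The bar operation\<close>

abbreviation gen_word :: "nat \<Rightarrow> nat \<Rightarrow> nat word" where
  "gen_word i j \<equiv> map (\<lambda>k. (k, True)) [i..<Suc j]"

text \<open>By von Dyck's theorem this says that sending the standard generators of W^+ to
  \<open>x\<close> extends to a homomorphism into \<open>G\<close>.\<close>

definition Wplus_gens :: "nat \<Rightarrow> ('g, 'm) monoid_scheme \<Rightarrow> (nat \<Rightarrow> 'g) \<Rightarrow> bool" where
  "Wplus_gens n G x \<longleftrightarrow> x \<in> {1..<n} \<rightarrow> carrier G \<and>
     (\<forall>r \<in> Wplus_relators n. eval_word G x r = \<one>\<^bsub>G\<^esub>)"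

text \<open>The substitution defining \<open>Wplus_bar\<close>, stated for an arbitrary group so
  that it can be moved along homomorphisms from W^+ to that group.\<close>

definition bar_gens :: "('g, 'm) monoid_scheme \<Rightarrow> (nat \<Rightarrow> 'g) \<Rightarrow> nat \<Rightarrow> 'g" where
  "bar_gens G x = (\<lambda>i. if i = 1 then inv\<^bsub>G\<^esub> (x 1)
     else if i = 2 then (x 1 [^]\<^bsub>G\<^esub> (2::nat)) \<otimes>\<^bsub>G\<^esub> x 2 else x i)"

lemma gen_word_words [simp]: "1 \<le> i \<Longrightarrow> j < n \<Longrightarrow> gen_word i j \<in> words {1..<n}"
  by (auto simp: words_def)

lemma Wplus_relators_words: "r \<in> Wplus_relators n \<Longrightarrow> r \<in> words {1..<n}"
  by (auto simp: Wplus_relators_def words_def)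

lemma ball_Wplus_relators:
  "(\<forall>r \<in> Wplus_relators n. Q r) \<longleftrightarrow>
     (\<forall>i j. 1 \<le> i \<longrightarrow> i < j \<longrightarrow> j < n \<longrightarrow> Q (gen_word i j @ gen_word i j))"
  unfolding Wplus_relators_def by blast

lemma (in group) Wplus_gens_iff:
  "Wplus_gens n G x \<longleftrightarrow> x \<in> {1..<n} \<rightarrow> carrier G \<and>
     (\<forall>i j. 1 \<le> i \<longrightarrow> i < j \<longrightarrow> j < n \<longrightarrow>
        eval_word G x (gen_word i j) \<otimes> eval_word G x (gen_word i j) = \<one>)"
proof (cases "x \<in> {1..<n} \<rightarrow> carrier G")
  case True
  have "eval_word G x (gen_word i j @ gen_word i j)
      = eval_word G x (gen_word i j) \<otimes> eval_word G x (gen_word i j)" if "1 \<le> i" "j < n" for i j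
    using that by (intro eval_word_append[OF True] gen_word_words)
  then show ?thesis
    unfolding Wplus_gens_def ball_Wplus_relators by metis
qed (simp add: Wplus_gens_def)

lemma (in group) Wplus_gensD:
  assumes "Wplus_gens n G x" "1 \<le> i" "i < j" "j < n"
  shows "eval_word G x (gen_word i j) \<otimes> eval_word G x (gen_word i j) = \<one>"
  using assms unfolding Wplus_gens_iff by blast

lemma (in group) bar_gens_closed:
  "x \<in> {1..<n} \<rightarrow> carrier G \<Longrightarrow> bar_gens G x \<in> {1..<n} \<rightarrow> carrier G"
  by (auto simp: bar_gens_def Pi_iff)

lemma (in group_hom) bar_gens_hom:
  "x \<in> {1..<n} \<rightarrow> carrier G \<Longrightarrow> i \<in> {1..<n} \<Longrightarrow> h (bar_gens G x i) = bar_gens H (h \<circ> x) i"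
  by (auto simp: bar_gens_def Pi_iff hom_nat_pow)

text \<open>This makes the bar map well defined on W^+. Put a = x_1 and b = x_2 ... x_j. The product
  from 1 to j becomes a^-1 a a b = a b and is unchanged, as are the products starting at 3 or later.
  The product from 2 to j becomes a a b, whose square is a (a b a) a b = (a b)^2 because a b a =
  b.\<close>

lemma (in group) Wplus_gens_bar:
  assumes "Wplus_gens n G x"
  shows "Wplus_gens n G (bar_gens G x)"
proof -
  have x: "x \<in> {1..<n} \<rightarrow> carrier G"
    using assms by (simp add: Wplus_gens_def)
  note rel = Wplus_gensD[OF assms]
  show ?thesis
    unfolding Wplus_gens_iff
  proof (intro conjI allI impI)
    show "bar_gens G x \<in> {1..<n} \<rightarrow> carrier G"
      using x by (rule bar_gens_closed)
  next
    fix i j :: nat assume ij: "1 \<le> i" "i < j" "j < n"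
    \<comment> \<open>The tail x_3 ... x_j, which is the empty product for j = 2.\<close>
    define c where "c = eval_word G x (gen_word 3 j)"
    have c: "c \<in> carrier G"
      unfolding c_def using x ij(3) by (intro eval_word_closed[OF x] gen_word_words) auto
    have bar3: "eval_word G (bar_gens G x) (gen_word k j) = eval_word G x (gen_word k j)" if "3 \<le> k" for k
      by (rule eval_word_cong[of "{3..<n}"]) (use that ij in \<open>auto simp: bar_gens_def words_def\<close>)
    have x12: "x 1 \<in> carrier G" "x 2 \<in> carrier G"
      using x ij by auto
    have upt2: "[2..<Suc j] = 2 # [3..<Suc j]" and upt1: "[1..<Suc j] = 1 # 2 # [3..<Suc j]"
      using ij upt_conv_Cons[of 1 "Suc j"] upt_conv_Cons[of 2 "Suc j"]
      by (simp_all add: eval_nat_numeral del: upt_Suc)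
    have p2: "eval_word G x (gen_word 2 j) = x 2 \<otimes> c" and p1: "eval_word G x (gen_word 1 j) = x 1 \<otimes> (x 2 \<otimes> c)"
      unfolding upt2 upt1 by (simp_all add: eval_word_Cons c_def del: upt_Suc)
    have b2: "eval_word G (bar_gens G x) (gen_word 2 j) = x 1 \<otimes> (x 1 \<otimes> (x 2 \<otimes> c))"
    proof -
      have "bar_gens G x 2 = x 1 \<otimes> (x 1 \<otimes> x 2)"
        using x12 by (simp add: bar_gens_def eval_nat_numeral m_assoc)
      then show ?thesis
        unfolding upt2 using x12 c bar3[of 3] by (simp add: eval_word_Cons c_def[symmetric] m_assoc del: upt_Suc)
    qed
    have b1: "eval_word G (bar_gens G x) (gen_word 1 j) = x 1 \<otimes> (x 2 \<otimes> c)"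
    proof -
      have "eval_word G (bar_gens G x) (gen_word 1 j)
          = inv (x 1) \<otimes> (x 1 \<otimes> (x 1 \<otimes> (x 2 \<otimes> c)))"
        using b2 unfolding upt1 upt2 by (simp add: eval_word_Cons bar_gens_def del: upt_Suc)
      then show ?thesis using x12 c by (simp add: m_assoc[symmetric])
    qed
    consider "i = 1" | "i = 2" | "3 \<le> i" using ij by linarith
    then show "eval_word G (bar_gens G x) (gen_word i j) \<otimes> eval_word G (bar_gens G x) (gen_word i j) = \<one>"
    proof cases
      case 1
      then show ?thesis using rel[of 1 j] ij b1 p1 by (simp del: upt_Suc)
    next
      case 2
      define a where "a = x 1"
      define b where "b = x 2 \<otimes> c"
      have ab: "a \<in> carrier G" "b \<in> carrier G" using x12 c by (auto simp: a_def b_def)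
      have bb: "b \<otimes> b = \<one>" using rel[of 2 j] ij 2 p2 by (simp add: b_def del: upt_Suc)
      have aa: "(a \<otimes> b) \<otimes> (a \<otimes> b) = \<one>"
        using rel[of 1 j] ij 2 p1 by (simp add: a_def b_def del: upt_Suc)
      \<comment> \<open>(a b)^2 = 1 makes a b a the inverse of b, and b is its own inverse.\<close>
      have "a \<otimes> b \<otimes> a = b"
        using ab aa bb by (metis inv_equality m_assoc m_closed)
      then have "a \<otimes> (a \<otimes> b) \<otimes> (a \<otimes> (a \<otimes> b)) = (a \<otimes> b) \<otimes> (a \<otimes> b)"
        using ab by (metis m_assoc m_closed)
      with aa show ?thesis using 2 b2 by (simp add: a_def b_def del: upt_Suc)
    next
      case 3
      then show ?thesis using rel[OF ij] bar3 by (simp del: upt_Suc)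
    qed
  qed
qed


section \<open>The group W^+, duality, and kernels closed under the bar map\<close>

lemma group_Wplus: "group (Wplus n)"
  unfolding Wplus_def by (rule group_pres_group)

lemma Wplus_gen_closed: "i \<in> {1..<n} \<Longrightarrow> Wplus_gen n i \<in> carrier (Wplus n)"
  unfolding Wplus_def Wplus_gen_def by simp

lemma Wplus_gens_Wplus_gen: "Wplus_gens n (Wplus n) (Wplus_gen n)"
proof -
  have "eval_word (Wplus n) (Wplus_gen n) r = \<one>\<^bsub>Wplus n\<^esub>" if "r \<in> Wplus_relators n" for r
    using eval_word_relator[OF that Wplus_relators_words[OF that]]
    by (simp add: Wplus_def Wplus_gen_def[abs_def])
  then show ?thesis
    by (auto simp: Wplus_gens_def Wplus_gen_closed)
qed

text \<open>The substitution turns the product from i to j into the inverse of the product of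
  \<open>x\<close> from n - j to n - i, whose square is one by the relations for
  \<open>x\<close>.\<close>

lemma (in group) Wplus_gens_dual:
  assumes "Wplus_gens n G x"
  shows "Wplus_gens n G (\<lambda>i. inv (x (n - i)))"
proof -
  have x: "x \<in> {1..<n} \<rightarrow> carrier G"
    using assms by (simp add: Wplus_gens_def)
  note rel = Wplus_gensD[OF assms]
  show ?thesis
    unfolding Wplus_gens_iff
  proof (intro conjI allI impI)
    show "(\<lambda>i. inv (x (n - i))) \<in> {1..<n} \<rightarrow> carrier G"
      using x by (auto simp: Pi_iff)
  next
    fix i j :: nat assume ij: "1 \<le> i" "i < j" "j < n"
    have "eval_word G (\<lambda>i. inv (x (n - i))) (map (\<lambda>k. (k, True)) ks)
        = eval_word G x (map (\<lambda>k. (n - k, False)) ks)" for ks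
      by (induction ks) (auto simp: eval_word_Cons)
    moreover have "map (\<lambda>k. (n - k, False)) [i..<Suc j] = inv_word (gen_word (n - j) (n - i))"
      using ij by (intro nth_equalityI) (auto simp: inv_word_def rev_nth simp del: upt_Suc)
    ultimately have "eval_word G (\<lambda>i. inv (x (n - i))) (gen_word i j)
        = inv (eval_word G x (gen_word (n - j) (n - i)))"
      using ij eval_word_inv_word[OF x gen_word_words[of "n - j" "n - i" n]] by (simp del: upt_Suc)
    moreover have "eval_word G x (gen_word (n - j) (n - i)) \<otimes> eval_word G x (gen_word (n - j) (n - i)) = \<one>"
      using ij by (intro rel) auto
    moreover have "eval_word G x (gen_word (n - j) (n - i)) \<in> carrier G"
      using ij by (intro eval_word_closed[OF x] gen_word_words) auto
    ultimately show "eval_word G (\<lambda>i. inv (x (n - i))) (gen_word i j)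
        \<otimes> eval_word G (\<lambda>i. inv (x (n - i))) (gen_word i j) = \<one>"
      by (simp add: inv_mult_group[symmetric] del: upt_Suc)
  qed
qed

text \<open>The class of \<open>w\<close> lies in the kernel N of the map from W^+ to the mix, so
  its bar image lies in N as well. Projecting to the first factor turns this into the claim about
  \<open>bar_gens G x\<close>.\<close>

lemma eval_bar_gens_eq_one:
  fixes G (structure)
  assumes G: "group G" and x: "Wplus_gens n G x" and z: "Wplus_gens n G z"
    and bar: "Wplus_bar n ` Wplus_kernel n (mix {1..<n} (G, x) (G, z))
        \<subseteq> Wplus_kernel n (mix {1..<n} (G, x) (G, z))"
    and w: "w \<in> words {1..<n}" "eval_word G x w = \<one>" "eval_word G z w = \<one>"
  shows "eval_word G (bar_gens G x) w = \<one>"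
proof -
  interpret group G by fact
  interpret GG: group "G \<times>\<times> G" using G G by (rule DirProd_group)
  define m where "m = (\<lambda>i. (x i, z i))"
  define M where "M = subgroup_generated (G \<times>\<times> G) (m ` {1..<n})"
  define h where "h = pres_hom M m"
  interpret M: group M unfolding M_def by simp
  interpret W: group "Wplus n" by (rule group_Wplus)
  have xc: "x \<in> {1..<n} \<rightarrow> carrier G" and zc: "z \<in> {1..<n} \<rightarrow> carrier G"
    using x z by (auto simp: Wplus_gens_def)
  have mGG: "m \<in> {1..<n} \<rightarrow> carrier (G \<times>\<times> G)"
    using xc zc by (auto simp: m_def)
  have mM: "m \<in> {1..<n} \<rightarrow> carrier M"
    using mGG by (auto simp: M_def carrier_subgroup_generated intro: generate.incl)
  have evM: "eval_word M m v = (eval_word G x v, eval_word G z v)" if "v \<in> words {1..<n}" for v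
    unfolding M_def GG.eval_word_subgroup_generated[OF mGG that]
    unfolding m_def by (rule eval_word_DirProd[OF G G xc zc that])
  have oneM: "\<one>\<^bsub>M\<^esub> = (\<one>, \<one>)"
    by (simp add: M_def)
  have relM: "eval_word M m r = \<one>\<^bsub>M\<^esub>" if "r \<in> Wplus_relators n" "r \<in> words {1..<n}" for r
    unfolding evM[OF that(2)] using that(1) x z by (simp add: Wplus_gens_def M_def)
  interpret h: group_hom "Wplus n" M h
    unfolding Wplus_def h_def by (rule M.group_hom_pres_hom[OF mM relM])
  have h_class: "h (pres_rel {1..<n} (Wplus_relators n) `` {v}) = eval_word M m v"
    if "v \<in> words {1..<n}" for v
    unfolding h_def by (rule M.pres_hom_class[OF mM relM that])
  have N: "Wplus_kernel n (mix {1..<n} (G, x) (G, z)) = kernel (Wplus n) M h"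
    by (simp add: Wplus_kernel_def mix_def M_def h_def m_def)
  let ?A = "pres_rel {1..<n} (Wplus_relators n) `` {w}"
  have "?A \<in> kernel (Wplus n) M h"
    using w by (simp add: kernel_def h_class[OF w(1)] evM[OF w(1)] oneM Wplus_def del: One_nat_def)
  then have "Wplus_bar n ?A \<in> kernel (Wplus n) M h"
    using bar N by auto
  moreover have bc: "bar_gens (Wplus n) (Wplus_gen n) \<in> {1..<n} \<rightarrow> carrier (Wplus n)"
    by (intro W.bar_gens_closed funcsetI Wplus_gen_closed)
  \<comment> \<open>Applying the bar map to the class of \<open>w\<close> amounts to evaluating
    \<open>w\<close> at the barred standard generators, since these satisfy the relations of
    W^+.\<close>
  have "Wplus_bar n ?A = eval_word (Wplus n) (bar_gens (Wplus n) (Wplus_gen n)) w"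
    unfolding Wplus_bar_def bar_gens_def[symmetric]
    using W.Wplus_gens_bar[OF Wplus_gens_Wplus_gen]
    by (intro W.pres_hom_class[OF bc _ w(1)]) (auto simp: Wplus_gens_def)
  ultimately have "h (eval_word (Wplus n) (bar_gens (Wplus n) (Wplus_gen n)) w) = \<one>\<^bsub>M\<^esub>"
    by (simp add: kernel_def)
  then have "fst (h (eval_word (Wplus n) (bar_gens (Wplus n) (Wplus_gen n)) w)) = \<one>"
    by (simp add: M_def)
  \<comment> \<open>Composing with the first projection gives the homomorphism from W^+ to
    \<open>G\<close> that sends the standard generators to \<open>x\<close>.\<close>
  moreover interpret k: group_hom "Wplus n" G "fst \<circ> h"
  proof (rule group_hom.intro)
    have "carrier M \<subseteq> carrier G \<times> carrier G"
      using GG.carrier_subgroup_generated_subset[of "m ` {1..<n}"] by (simp add: M_def)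
    then have "fst \<in> hom M G"
      by (auto simp: hom_def M_def mult_DirProd')
    then show "group_hom_axioms (Wplus n) G (fst \<circ> h)"
      using h.homh by (intro group_hom_axioms.intro) (rule Group.hom_compose)
  qed (rule W.group_axioms, rule G)
  have gen: "(fst \<circ> h) (Wplus_gen n i) = x i" if "i \<in> {1..<n}" for i
  proof -
    have "h (Wplus_gen n i) = (eval_word G x [(i, True)], eval_word G z [(i, True)])"
      unfolding Wplus_gen_def using that h_class[of "[(i, True)]"] evM[of "[(i, True)]"] by simp
    moreover have "x i \<in> carrier G" using xc that by auto
    ultimately show ?thesis by (simp add: eval_word_Cons)
  qed
  have "(fst \<circ> h) (eval_word (Wplus n) (bar_gens (Wplus n) (Wplus_gen n)) w)
      = eval_word G (bar_gens G x) w"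
  proof -
    have "(fst \<circ> h) (eval_word (Wplus n) (bar_gens (Wplus n) (Wplus_gen n)) w)
        = eval_word G ((fst \<circ> h) \<circ> bar_gens (Wplus n) (Wplus_gen n)) w"
      by (rule k.eval_word_hom[OF bc w(1)])
    also have "\<dots> = eval_word G (bar_gens G x) w"
    proof (rule eval_word_cong[OF _ w(1)])
      fix i assume i: "i \<in> {1..<n}"
      have "((fst \<circ> h) \<circ> bar_gens (Wplus n) (Wplus_gen n)) i = bar_gens G ((fst \<circ> h) \<circ> Wplus_gen n) i"
        using k.bar_gens_hom[of "Wplus_gen n" n i] i Wplus_gen_closed by auto
      also have "\<dots> = bar_gens G x i"
        using i gen by (auto simp: bar_gens_def)
      finally show "((fst \<circ> h) \<circ> bar_gens (Wplus n) (Wplus_gen n)) i = bar_gens G x i" .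
    qed
    finally show ?thesis .
  qed
  ultimately show ?thesis by simp
qed

section \<open>The subgroup generated by the barred and by the dual generators; orders of the barred
  generators\<close>

lemma (in group) generate_eqI:
  assumes "A \<subseteq> generate G B" "B \<subseteq> generate G A" "A \<subseteq> carrier G" "B \<subseteq> carrier G"
  shows "generate G A = generate G B"
  using assms by (meson generate_is_subgroup generate_subgroup_incl subset_antisym)

lemma (in group) generate_bar_gens_subset:
  assumes "x \<in> {1..<n} \<rightarrow> carrier G"
  shows "bar_gens G x ` {1..<n} \<subseteq> generate G (x ` {1..<n})"
proof clarify
  fix i assume i: "i \<in> {1..<n}"
  have "subgroup (generate G (x ` {1..<n})) G"
    using assms by (intro generate_is_subgroup) auto
  moreover have "x j \<in> generate G (x ` {1..<n})" if "j \<in> {1..<n}" for j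
    using that by (auto intro: generate.incl)
  ultimately show "bar_gens G x i \<in> generate G (x ` {1..<n})"
    using i by (auto simp: bar_gens_def numeral_2_eq_2 subgroup.m_closed subgroup.m_inv_closed
        subgroup.one_closed subgroup.mem_carrier)
qed

text \<open>The bar substitution is an involution on tuples: the second entry becomes x_1^-2 (x_1^2
  x_2) = x_2. The inclusion already shown, applied to the barred tuple, therefore gives the reverse
  one.\<close>

lemma (in group) generate_bar_gens:
  assumes x: "x \<in> {1..<n} \<rightarrow> carrier G"
  shows "generate G (bar_gens G x ` {1..<n}) = generate G (x ` {1..<n})"
proof (rule generate_eqI)
  have "bar_gens G (bar_gens G x) i = x i" if "i \<in> {1..<n}" for i
  proof -
    have "x 1 \<in> carrier G" "i = 2 \<Longrightarrow> x 2 \<in> carrier G"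
      using that x by auto
    then show ?thesis
      by (auto simp: bar_gens_def numeral_2_eq_2 m_assoc) (simp add: m_assoc[symmetric])
  qed
  then have "x ` {1..<n} = bar_gens G (bar_gens G x) ` {1..<n}" by simp
  then show "x ` {1..<n} \<subseteq> generate G (bar_gens G x ` {1..<n})"
    using generate_bar_gens_subset[OF bar_gens_closed[OF x]] by simp
qed (use x bar_gens_closed[OF x] generate_bar_gens_subset[OF x] in auto)

lemma (in group) generate_dual_gens:
  fixes n :: nat
  assumes x: "x \<in> {1..<n} \<rightarrow> carrier G"
  shows "generate G ((\<lambda>i. inv (x (n - i))) ` {1..<n}) = generate G (x ` {1..<n})"
proof (rule generate_eqI)
  show "(\<lambda>i. inv (x (n - i))) ` {1..<n} \<subseteq> generate G (x ` {1..<n})"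
  proof clarify
    fix i assume "i \<in> {1..<n}"
    then have "n - i \<in> {1..<n}" by auto
    then show "inv (x (n - i)) \<in> generate G (x ` {1..<n})"
      by (intro generate.inv imageI)
  qed
  show "x ` {1..<n} \<subseteq> generate G ((\<lambda>i. inv (x (n - i))) ` {1..<n})"
  proof clarify
    fix i assume i: "i \<in> {1..<n}"
    then have "n - i \<in> {1..<n}" by auto
    then have "inv (x (n - (n - i))) \<in> (\<lambda>i. inv (x (n - i))) ` {1..<n}" by (rule imageI)
    then have "inv (inv (x (n - (n - i)))) \<in> generate G ((\<lambda>i. inv (x (n - i))) ` {1..<n})"
      by (rule generate.inv)
    moreover have "n - (n - i) = i" "x i \<in> carrier G" using i x by auto
    ultimately show "x i \<in> generate G ((\<lambda>i. inv (x (n - i))) ` {1..<n})" by simp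
  qed
qed (use x in \<open>auto simp: Pi_iff\<close>)

lemma (in group) nat_pow_conjugate:
  assumes "a \<in> carrier G" "c \<in> carrier G"
  shows "(a \<otimes> c \<otimes> inv a) [^] (k::nat) = a \<otimes> c [^] k \<otimes> inv a"
proof (induction k)
  case (Suc k)
  have "inv a \<otimes> (a \<otimes> c \<otimes> inv a) = c \<otimes> inv a"
    using assms by (simp add: m_assoc[symmetric])
  then have "a \<otimes> c [^] k \<otimes> inv a \<otimes> (a \<otimes> c \<otimes> inv a) = a \<otimes> c [^] k \<otimes> (c \<otimes> inv a)"
    using assms by (simp add: m_assoc)
  also have "\<dots> = a \<otimes> (c [^] k \<otimes> c) \<otimes> inv a"
    using assms by (simp add: m_assoc)
  finally show ?case using Suc by simp
qed (use assms in simp)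

text \<open>For i = 2 the relation (x_1 x_2)^2 = 1 reads x_1 x_2 = x_2^-1 x_1^-1. Multiplying by x_1
  on the left exhibits x_1^2 x_2 as a conjugate of x_2^-1. The other entries are x_1^-1 or
  unchanged.\<close>

lemma (in group) bar_gens_pow_ord:
  assumes "Wplus_gens n G x" "i \<in> {1..<n}"
  shows "bar_gens G x i [^] ord (x i) = \<one>"
proof -
  have x: "x \<in> {1..<n} \<rightarrow> carrier G"
    using assms by (simp add: Wplus_gens_def)
  then have xi: "x i \<in> carrier G" "x 1 \<in> carrier G" using assms(2) by auto
  show ?thesis
  proof (cases "i = 2")
    case True
    let ?a = "x 1" and ?b = "x 2"
    have "?a \<otimes> ?b \<otimes> (?a \<otimes> ?b) = \<one>"
      using Wplus_gensD[OF assms(1), of 1 2] assms(2) True xi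
      by (simp add: eval_word_Cons eval_nat_numeral)
    then have "?a \<otimes> ?b = inv (?a \<otimes> ?b)"
      using xi True by (simp add: inv_equality)
    then have "?a \<otimes> ?b = inv ?b \<otimes> inv ?a"
      using xi True by (simp add: inv_mult_group)
    then have "?a \<otimes> (?a \<otimes> ?b) = ?a \<otimes> inv ?b \<otimes> inv ?a"
      using xi True by (simp add: m_assoc)
    then have "bar_gens G x i = ?a \<otimes> inv ?b \<otimes> inv ?a"
      using xi True by (simp add: bar_gens_def numeral_2_eq_2 m_assoc)
    then show ?thesis
      using xi True nat_pow_conjugate[of ?a "inv ?b" "ord ?b"] by (simp add: nat_pow_inv)
  qed (use xi in \<open>auto simp: bar_gens_def nat_pow_inv\<close>)
qed

text \<open>The contrapositive of the criterion, for tuples in one finite group. Both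
  \<open>y\<close> and \<open>z\<close> generate the same subgroup as \<open>x\<close>, so each
  comix order times the size of its set of relator values is the order of that subgroup. The bound
  between the two sets then passes to the comixes on cancelling \<open>card ?S\<close>.\<close>

lemma comix_order_bound:
  fixes G (structure) and n :: nat
  defines "I \<equiv> {1..<n}"
  assumes G: "group G" and fin: "finite (carrier G)" and x: "Wplus_gens n G x"
    and y: "\<And>i. i \<in> I \<Longrightarrow> y i = bar_gens G x i"
    and z: "\<And>i. i \<in> I \<Longrightarrow> z i = inv (x (n - i))"
    and p: "\<And>i. i \<in> I \<Longrightarrow> p i = group.ord G (x i)"
    and bar: "Wplus_bar n ` Wplus_kernel n (mix I (G, x) (G, z)) \<subseteq> Wplus_kernel n (mix I (G, x) (G, z))"
  shows "Lcm ((\<lambda>i. lcm (p i) (p (n - i)) div p i) ` I) * order (comix I (G, x) (G, z))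
    \<le> order (comix I (G, x) (G, y))"
proof -
  interpret group G by fact
  let ?L = "Lcm ((\<lambda>i. lcm (p i) (p (n - i)) div p i) ` I)"
  let ?S = "relator_values I G x y" and ?T = "relator_values I G x z"
  have xc: "x \<in> I \<rightarrow> carrier G" using x by (simp add: Wplus_gens_def I_def)
  have yc: "y \<in> I \<rightarrow> carrier G" using bar_gens_closed[of x n] xc y by (auto simp: I_def Pi_iff)
  have dual: "n - i \<in> I" if "i \<in> I" for i using that by (auto simp: I_def)
  have zc: "z \<in> I \<rightarrow> carrier G" using xc z dual by (auto simp: Pi_iff)
  have zW: "Wplus_gens n G z"
  proof -
    have "eval_word G z r = eval_word G (\<lambda>i. inv (x (n - i))) r" if "r \<in> Wplus_relators n" for r
      using Wplus_relators_words[OF that] by (intro eval_word_cong[OF z]) (simp_all add: I_def)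
    then show ?thesis
      using Wplus_gens_dual[OF x] zc by (simp add: Wplus_gens_def I_def)
  qed
  have "?L * card ?S \<le> card ?T"
  proof (rule card_relator_values_mono[OF fin xc yc zc])
    fix w assume w: "w \<in> words I" "eval_word G x w = \<one>" "eval_word G z w = \<one>"
    then have "eval_word G (bar_gens G x) w = \<one>"
      unfolding I_def by (intro eval_bar_gens_eq_one[OF G x zW bar[unfolded I_def]])
    then show "eval_word G y w = \<one>"
      using eval_word_cong[OF y w(1), where G = G] by simp
  next
    fix i assume i: "i \<in> I"
    \<comment> \<open>The power of the generator i with exponent p_i: trivial under
      \<open>x\<close>, hence under \<open>y\<close> by \<open>bar_gens_pow_ord\<close>, while
      \<open>z\<close> sends it to a power of the inverse of \<open>x (n - i)\<close>.\<close>
    let ?w = "replicate (p i) (i, True)"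
    have xi: "x i \<in> carrier G" "y i \<in> carrier G" "z i \<in> carrier G" "x (n - i) \<in> carrier G"
      using i xc yc zc dual by auto
    have "p i > 0" using p[OF i] ord_ge_1[OF fin xi(1)] by simp
    \<comment> \<open>z_i is the inverse of x_(n-i) and so has order p_(n-i); a power divides this
      order by its gcd with the exponent.\<close>
    have "ord (z i [^] p i) = p (n - i) div gcd (p (n - i)) (p i)"
      using \<open>p i > 0\<close> xi p[OF dual[OF i]] z[OF i] by (simp add: ord_pow_gen)
    also have "\<dots> = lcm (p i) (p (n - i)) div p i"
      using \<open>p i > 0\<close> by (simp add: lcm_nat_def gcd.commute div_mult_swap[symmetric])
    finally have "ord (eval_word G z ?w) = lcm (p i) (p (n - i)) div p i"
      using xi by (simp add: eval_word_power)
    moreover have "eval_word G x ?w = \<one>"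
      using xi p[OF i] by (simp add: eval_word_power)
    moreover have "eval_word G y ?w = \<one>"
      using xi p[OF i] y[OF i] bar_gens_pow_ord[OF x, of i] i by (simp add: eval_word_power I_def)
    moreover have "?w \<in> words I"
      using i by (auto simp: words_def)
    ultimately show "\<exists>w\<in>words I. eval_word G x w = \<one> \<and> eval_word G y w = \<one> \<and>
        ord (eval_word G z w) = lcm (p i) (p (n - i)) div p i"
      by blast
  qed
  moreover have "generate G (y ` I) = generate G (z ` I)"
  proof -
    have "y ` I = bar_gens G x ` I" "z ` I = (\<lambda>i. inv (x (n - i))) ` I"
      using y z by auto
    then show ?thesis
      using xc generate_bar_gens[of x n] generate_dual_gens[of x n] by (simp add: I_def)
  qed
  then have "order (comix I (G, x) (G, y)) * card ?S = order (comix I (G, x) (G, z)) * card ?T"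
    using order_comix[OF G xc yc] order_comix[OF G xc zc] by simp
  moreover from calculation(1)
  have "order (comix I (G, x) (G, z)) * (?L * card ?S) \<le> order (comix I (G, x) (G, z)) * card ?T"
    by (rule mult_le_mono2)
  ultimately have "(?L * order (comix I (G, x) (G, z))) * card ?S \<le> order (comix I (G, x) (G, y)) * card ?S"
    by (simp add: ac_simps)
  moreover have "card ?S > 0"
    using subgroup_relator_values[OF xc yc] fin by (rule subgroup.finite_imp_card_positive)
  ultimately show ?thesis by simp
qed

section \<open>Flags of a finite polytope\<close>

lemma flags_mirror_image [simp]: "flags (mirror_image P) = flags P"
  by (simp add: flags_def mirror_image_def)

lemma adj_flag_mirror_image [simp]: "adj_flag (mirror_image P) j \<Phi> = adj_flag P j \<Phi>"
  by (simp add: adj_flag_def) (simp add: mirror_image_def)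

lemma aut_group_mirror_image [simp]: "aut_group (mirror_image P) = aut_group P"
  by (simp add: aut_group_def mirror_image_def)

lemma flags_dual_polytope [simp]: "flags (dual_polytope n P) = flags P"
proof -
  have "Chains ((leq P)\<inverse>) = Chains (leq P)"
    by (auto simp: Chains_def)
  then show ?thesis by (simp add: flags_def dual_polytope_def)
qed

lemma adj_flag_dual_polytope: "adj_flag (dual_polytope n P) j \<Phi> = adj_flag P (int n - 1 - j) \<Phi>"
proof -
  have "int n - 1 - r \<noteq> j \<longleftrightarrow> r \<noteq> int n - 1 - j" for r by auto
  then show ?thesis
    by (simp add: adj_flag_def) (simp add: dual_polytope_def)
qed

lemma aut_group_dual_polytope [simp]: "aut_group (dual_polytope n P) = aut_group P"
  by (auto simp: aut_group_def dual_polytope_def)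

section \<open>The faces of a flag, one for each rank\<close>

definition face_at :: "'a rooted_poset \<Rightarrow> 'a set \<Rightarrow> int \<Rightarrow> 'a" where
  "face_at P \<Phi> j = (THE F. F \<in> \<Phi> \<and> face_rank P F = j)"

locale finite_polytope =
  fixes n :: nat and P :: "'a rooted_poset"
  assumes polytope: "polytope n P" and finite_faces: "finite (faces P)"
begin

abbreviation "rk \<equiv> face_rank P"

lemma leq_faces: "(F, G) \<in> leq P \<Longrightarrow> F \<in> faces P \<and> G \<in> faces P"
  using polytope by (auto simp: polytope_def partial_order_on_def preorder_on_def)

lemma leq_refl: "F \<in> faces P \<Longrightarrow> (F, F) \<in> leq P"
  using polytope by (auto simp: polytope_def partial_order_on_def preorder_on_def refl_on_def)

lemma leq_trans: "(F, G) \<in> leq P \<Longrightarrow> (G, H) \<in> leq P \<Longrightarrow> (F, H) \<in> leq P"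
  using polytope unfolding polytope_def partial_order_on_def preorder_on_def by (meson transE)

lemma rk_range: "F \<in> faces P \<Longrightarrow> -1 \<le> rk F \<and> rk F \<le> int n"
  using polytope by (auto simp: polytope_def Pi_iff)

lemma lt_rk: "lt P F G \<Longrightarrow> rk F < rk G"
  using polytope by (auto simp: polytope_def)

lemma leq_rk: "(F, G) \<in> leq P \<Longrightarrow> rk F \<le> rk G"
  using lt_rk[of F G] by (cases "F = G") (auto simp: lt_def)

lemma card_flag: "\<Phi> \<in> flags P \<Longrightarrow> card \<Phi> = n + 2"
  using polytope by (auto simp: polytope_def)

lemma chain_faces: "C \<in> Chains (leq P) \<Longrightarrow> C \<subseteq> faces P"
  using leq_faces by (fastforce simp: Chains_def)

lemma chain_inj_rk: "C \<in> Chains (leq P) \<Longrightarrow> inj_on rk C"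
  unfolding inj_on_def Chains_def using lt_rk by (fastforce simp: lt_def)

lemma chain_finite: "C \<in> Chains (leq P) \<Longrightarrow> finite C"
  using chain_faces finite_faces finite_subset by blast

lemma chain_rk: "C \<in> Chains (leq P) \<Longrightarrow> rk ` C \<subseteq> {-1..int n}"
  using chain_faces rk_range by fastforce

lemma card_chain_le: "C \<in> Chains (leq P) \<Longrightarrow> card C \<le> n + 2"
  using card_mono[OF _ chain_rk[of C]] card_image[OF chain_inj_rk, of C] by simp

lemma flag_chain: "\<Phi> \<in> flags P \<Longrightarrow> \<Phi> \<in> Chains (leq P)"
  by (simp add: flags_def)

text \<open>Distinct faces of a chain have distinct ranks, so no chain has more than n + 2 faces,
  and one of that size cannot be enlarged.\<close>

lemma chain_flagI:
  assumes C: "C \<in> Chains (leq P)" "card C = n + 2"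
  shows "C \<in> flags P"
  unfolding flags_def
proof (intro CollectI conjI ballI impI)
  fix D assume D: "D \<in> Chains (leq P)" "C \<subseteq> D"
  then have "card C = card D"
    using C card_chain_le[of D] card_mono[OF chain_finite[OF D(1)] D(2)] by simp
  then show "D = C"
    using card_subset_eq[OF chain_finite[OF D(1)] D(2)] by simp
qed fact

text \<open>Ranks are injective on a flag, and its n + 2 faces must fill all n + 2 values.\<close>

lemma flag_rk_image: "\<Phi> \<in> flags P \<Longrightarrow> rk ` \<Phi> = {-1..int n}"
  using chain_rk[of \<Phi>] card_flag[of \<Phi>] card_image[OF chain_inj_rk, of \<Phi>] flag_chain[of \<Phi>]
  by (intro card_subset_eq) auto

text \<open>Among the finitely many chains containing \<open>F\<close> there is a maximal one, and
  it is maximal among all chains.\<close>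

lemma face_in_flag: "F \<in> faces P \<Longrightarrow> \<exists>\<Phi> \<in> flags P. F \<in> \<Phi>"
proof -
  assume F: "F \<in> faces P"
  let ?S = "{C \<in> Chains (leq P). F \<in> C}"
  have "finite ?S"
    using chain_faces finite_faces by (intro finite_subset[of ?S "Pow (faces P)"]) auto
  moreover have "{F} \<in> ?S" using F by (auto simp: Chains_def leq_refl)
  ultimately obtain C where C: "C \<in> ?S" "\<And>D. D \<in> ?S \<Longrightarrow> C \<subseteq> D \<Longrightarrow> D = C"
    using finite_has_maximal2[of ?S "{F}"] by blast
  then have "C \<in> flags P" by (auto simp: flags_def)
  with C show ?thesis by blast
qed

lemma flag_face_unique:
  "\<Phi> \<in> flags P \<Longrightarrow> F \<in> \<Phi> \<Longrightarrow> G \<in> \<Phi> \<Longrightarrow> rk F = rk G \<Longrightarrow> F = G"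
  using chain_inj_rk[OF flag_chain] by (auto dest: inj_onD)

lemma face_at_eq: "\<Phi> \<in> flags P \<Longrightarrow> F \<in> \<Phi> \<Longrightarrow> face_at P \<Phi> (rk F) = F"
  unfolding face_at_def by (rule the_equality) (auto intro: flag_face_unique)

lemma face_at:
  assumes "\<Phi> \<in> flags P" "-1 \<le> j" "j \<le> int n"
  shows "face_at P \<Phi> j \<in> \<Phi>" "rk (face_at P \<Phi> j) = j"
proof -
  have "j \<in> rk ` \<Phi>" using assms flag_rk_image by auto
  then obtain F where "F \<in> \<Phi>" "rk F = j" by auto
  then show "face_at P \<Phi> j \<in> \<Phi>" "rk (face_at P \<Phi> j) = j"
    using face_at_eq[OF assms(1), of F] by auto
qed

lemma flag_subset_faces: "\<Phi> \<in> flags P \<Longrightarrow> \<Phi> \<subseteq> faces P"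
  using chain_faces flag_chain by blast

lemma flag_rk: "\<Phi> \<in> flags P \<Longrightarrow> F \<in> \<Phi> \<Longrightarrow> -1 \<le> rk F \<and> rk F \<le> int n"
  using flag_subset_faces rk_range by blast

lemma flag_eqI:
  assumes "\<Phi> \<in> flags P" "\<Psi> \<in> flags P"
    and "\<And>j. -1 \<le> j \<Longrightarrow> j \<le> int n \<Longrightarrow> face_at P \<Phi> j = face_at P \<Psi> j"
  shows "\<Phi> = \<Psi>"
proof -
  have "A \<subseteq> B" if "A \<in> flags P" "B \<in> flags P"
    "\<And>j. -1 \<le> j \<Longrightarrow> j \<le> int n \<Longrightarrow> face_at P A j = face_at P B j" for A B
  proof
    fix F assume F: "F \<in> A"
    then have "F = face_at P B (rk F)"
      using that face_at_eq[of A F] flag_rk[of A F] by metis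
    then show "F \<in> B"
      using that(1,2) F flag_rk[of A F] face_at(1)[of B "rk F"] by auto
  qed
  with assms show ?thesis by (metis subset_antisym)
qed

lemma flag_leq:
  assumes "\<Phi> \<in> flags P" "F \<in> \<Phi>" "G \<in> \<Phi>" "rk F \<le> rk G"
  shows "(F, G) \<in> leq P"
proof -
  have "(F, G) \<in> leq P \<or> (G, F) \<in> leq P"
    using flag_chain[OF assms(1)] assms by (auto simp: Chains_def)
  moreover have "(F, G) \<in> leq P" if "(G, F) \<in> leq P"
  proof -
    have "F = G" using leq_rk[OF that] assms by (intro flag_face_unique[OF assms(1)]) auto
    then show ?thesis using that by simp
  qed
  ultimately show ?thesis by blast
qed

section \<open>Diamonds and adjacent flags\<close>

definition between :: "'a set \<Rightarrow> int \<Rightarrow> 'a set" where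
  "between \<Phi> j = {H \<in> faces P. rk H = j \<and> lt P (face_at P \<Phi> (j - 1)) H \<and> lt P H (face_at P \<Phi> (j + 1))}"

lemma card_between:
  assumes "\<Phi> \<in> flags P" "0 \<le> j" "j < int n"
  shows "card (between \<Phi> j) = 2"
proof -
  have "rk (face_at P \<Phi> (j - 1)) = j - 1" "rk (face_at P \<Phi> (j + 1)) = j + 1"
    "face_at P \<Phi> (j - 1) \<in> \<Phi>" "face_at P \<Phi> (j + 1) \<in> \<Phi>"
    using assms face_at[of \<Phi>] by auto
  moreover from this have "lt P (face_at P \<Phi> (j - 1)) (face_at P \<Phi> (j + 1))"
    using flag_leq[OF assms(1)] unfolding lt_def by force
  ultimately show ?thesis
    using polytope unfolding polytope_def diamond_condition_def between_def by blast
qed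

lemma face_at_between:
  assumes "\<Phi> \<in> flags P" "0 \<le> j" "j < int n"
  shows "face_at P \<Phi> j \<in> between \<Phi> j"
proof -
  have r: "rk (face_at P \<Phi> (j - 1)) = j - 1" "rk (face_at P \<Phi> (j + 1)) = j + 1"
    "rk (face_at P \<Phi> j) = j"
    and m: "face_at P \<Phi> (j - 1) \<in> \<Phi>" "face_at P \<Phi> (j + 1) \<in> \<Phi>" "face_at P \<Phi> j \<in> \<Phi>"
    using assms face_at[of \<Phi>] by auto
  then have "lt P (face_at P \<Phi> (j - 1)) (face_at P \<Phi> j)" "lt P (face_at P \<Phi> j) (face_at P \<Phi> (j + 1))"
    using flag_leq[OF assms(1)] unfolding lt_def by force+
  then show ?thesis
    using r m flag_subset_faces[OF assms(1)] by (auto simp: between_def)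
qed

text \<open>Serves both for the two faces inside a diamond and for the two flag orbits of a chiral
  polytope.\<close>

lemma card_2_third:
  assumes "card A = 2" "a \<in> A" "b \<in> A" "c \<in> A" "a \<noteq> b" "c \<noteq> b"
  shows "a = c"
  using assms by (auto simp: card_2_iff)

text \<open>Existence: the diamond condition offers a second face \<open>G\<close> of rank j, and
  exchanging \<open>F\<close> for \<open>G\<close> keeps a chain of n + 2 faces. Uniqueness: another
  solution has the same faces of ranks j - 1 and j + 1, so its j-face lies in the same
  diamond.\<close>

lemma ex_adj_flag:
  assumes \<Phi>: "\<Phi> \<in> flags P" and j: "0 \<le> j" "j < int n"
  shows "\<exists>!\<Psi>. \<Psi> \<in> flags P \<and> \<Psi> \<noteq> \<Phi> \<and> {F \<in> \<Psi>. rk F \<noteq> j} = {F \<in> \<Phi>. rk F \<noteq> j}"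
proof -
  define F where "F = face_at P \<Phi> j"
  define A where "A = face_at P \<Phi> (j - 1)"
  define B where "B = face_at P \<Phi> (j + 1)"
  have r: "rk A = j - 1" "rk B = j + 1" "rk F = j" and m: "A \<in> \<Phi>" "B \<in> \<Phi>" "F \<in> \<Phi>"
    using \<Phi> j face_at[of \<Phi>] by (auto simp: A_def B_def F_def)
  have F: "F \<in> between \<Phi> j" unfolding F_def using \<Phi> j by (rule face_at_between)
  obtain G where G: "G \<in> between \<Phi> j" "G \<noteq> F"
    using card_between[OF \<Phi> j] F by (metis card_2_iff')
  have G': "rk G = j" "G \<in> faces P" "(A, G) \<in> leq P" "(G, B) \<in> leq P"
    using G(1) by (auto simp: between_def lt_def A_def B_def)
  define \<Psi> where "\<Psi> = insert G (\<Phi> - {F})"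
  have offj: "{H \<in> \<Phi>. rk H \<noteq> j} = \<Phi> - {F}"
    using r m flag_face_unique[OF \<Phi>] by auto
  have GPhi: "G \<notin> \<Phi>" using G G' r m flag_face_unique[OF \<Phi>, of G F] by auto
  have comp: "(H, G) \<in> leq P \<or> (G, H) \<in> leq P" if "H \<in> \<Phi> - {F}" for H
  proof -
    have "rk H \<noteq> j" using that offj by auto
    then consider "rk H \<le> j - 1" | "rk H \<ge> j + 1" by linarith
    then show ?thesis
    proof cases
      case 1
      then have "(H, A) \<in> leq P" using that r m by (intro flag_leq[OF \<Phi>]) auto
      then show ?thesis using G' leq_trans by blast
    next
      case 2
      then have "(B, H) \<in> leq P" using that r m by (intro flag_leq[OF \<Phi>]) auto
      then show ?thesis using G' leq_trans by blast
    qed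
  qed
  have "\<Psi> \<in> Chains (leq P)"
    using flag_chain[OF \<Phi>] comp leq_refl[OF G'(2)] unfolding \<Psi>_def Chains_def by blast
  moreover have "card \<Psi> = n + 2"
    unfolding \<Psi>_def using card_flag[OF \<Phi>] m GPhi chain_finite[OF flag_chain[OF \<Phi>]]
    by (simp add: card_Suc_Diff1 del: card_Diff_insert)
  ultimately have "\<Psi> \<in> flags P" by (rule chain_flagI)
  moreover have "\<Psi> \<noteq> \<Phi>" using GPhi by (auto simp: \<Psi>_def)
  moreover have "{H \<in> \<Psi>. rk H \<noteq> j} = {H \<in> \<Phi>. rk H \<noteq> j}"
    unfolding offj using offj G' by (auto simp: \<Psi>_def)
  moreover have "\<Psi>' = \<Psi>" if \<Psi>': "\<Psi>' \<in> flags P" "\<Psi>' \<noteq> \<Phi>"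
    "{H \<in> \<Psi>'. rk H \<noteq> j} = {H \<in> \<Phi>. rk H \<noteq> j}" for \<Psi>'
  proof -
    define G' where "G' = face_at P \<Psi>' j"
    have g: "G' \<in> \<Psi>'" "rk G' = j" using \<Psi>'(1) j face_at[of \<Psi>' j] by (auto simp: G'_def)
    have \<Psi>'_eq: "\<Psi>' = insert G' (\<Phi> - {F})"
      using \<Psi>'(3) offj g flag_face_unique[OF \<Psi>'(1)] by auto
    have AB: "A \<in> \<Psi>'" "B \<in> \<Psi>'" using \<Psi>'_eq m r by auto
    then have "face_at P \<Psi>' (j - 1) = A" "face_at P \<Psi>' (j + 1) = B"
      using face_at_eq[OF \<Psi>'(1)] r by metis+
    \<comment> \<open>The set \<open>between\<close> depends on the flag only through its faces of
      ranks j - 1 and j + 1.\<close>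
    then have "between \<Psi>' j = between \<Phi> j" by (simp add: between_def A_def B_def)
    then have "G' \<in> between \<Phi> j" using face_at_between[OF \<Psi>'(1) j] by (simp add: G'_def)
    moreover have "G' \<noteq> F" using \<Psi>'_eq \<Psi>'(2) m by auto
    ultimately have "G' = G" using card_2_third[OF card_between[OF \<Phi> j] _ F G(1)] G(2) by blast
    then show ?thesis using \<Psi>'_eq by (simp add: \<Psi>_def)
  qed
  ultimately show ?thesis
    by (intro ex1I[of _ \<Psi>] conjI) (elim conjE, assumption | blast)+
qed

lemma adj_flag:
  assumes "\<Phi> \<in> flags P" "0 \<le> j" "j < int n"
  shows adj_flag_in_flags: "adj_flag P j \<Phi> \<in> flags P"
    and adj_flag_neq: "adj_flag P j \<Phi> \<noteq> \<Phi>"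
    and adj_flag_off: "{F \<in> adj_flag P j \<Phi>. rk F \<noteq> j} = {F \<in> \<Phi>. rk F \<noteq> j}"
  using theI'[OF ex_adj_flag[OF assms]] unfolding adj_flag_def by blast+

lemma adj_flagI:
  assumes "\<Phi> \<in> flags P" "0 \<le> j" "j < int n" "\<Psi> \<in> flags P" "\<Psi> \<noteq> \<Phi>"
    "{F \<in> \<Psi>. rk F \<noteq> j} = {F \<in> \<Phi>. rk F \<noteq> j}"
  shows "adj_flag P j \<Phi> = \<Psi>"
  using the1_equality[OF ex_adj_flag[OF assms(1-3)], of \<Psi>] assms(4-) unfolding adj_flag_def by blast

lemma adj_flag_adj_flag:
  assumes "\<Phi> \<in> flags P" "0 \<le> j" "j < int n"
  shows "adj_flag P j (adj_flag P j \<Phi>) = \<Phi>"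
  using adj_flag[OF assms] assms by (intro adj_flagI) auto

lemma face_at_adj_flag_off:
  assumes "\<Phi> \<in> flags P" "0 \<le> j" "j < int n" "-1 \<le> k" "k \<le> int n" "k \<noteq> j"
  shows "face_at P (adj_flag P j \<Phi>) k = face_at P \<Phi> k"
proof -
  have "face_at P \<Phi> k \<in> {F \<in> \<Phi>. rk F \<noteq> j}"
    using face_at[OF assms(1,4,5)] assms(6) by simp
  then have "face_at P \<Phi> k \<in> adj_flag P j \<Phi>"
    unfolding adj_flag_off[OF assms(1-3), symmetric] by simp
  then show ?thesis
    using face_at_eq[OF adj_flag_in_flags[OF assms(1-3)]] face_at(2)[OF assms(1,4,5)] by metis
qed

lemma face_at_adj_flag_neq:
  assumes "\<Phi> \<in> flags P" "0 \<le> j" "j < int n"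
  shows "face_at P (adj_flag P j \<Phi>) j \<noteq> face_at P \<Phi> j"
proof
  assume "face_at P (adj_flag P j \<Phi>) j = face_at P \<Phi> j"
  then have "adj_flag P j \<Phi> = \<Phi>"
    using face_at_adj_flag_off[OF assms]
    by (intro flag_eqI[OF adj_flag_in_flags[OF assms] assms(1)]) metis
  with adj_flag_neq[OF assms] show False by simp
qed

text \<open>Equal neighbours put the j-faces of \<Phi> and \<Psi> into the same diamond. As these
  two faces differ, changing \<Psi> at rank j produces that of \<Phi>.\<close>

lemma face_at_adj_flag_swap:
  assumes \<Phi>: "\<Phi> \<in> flags P" and \<Psi>: "\<Psi> \<in> flags P" and j: "0 \<le> j" "j < int n"
    and "face_at P \<Phi> (j - 1) = face_at P \<Psi> (j - 1)" "face_at P \<Phi> (j + 1) = face_at P \<Psi> (j + 1)"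
    and "face_at P \<Phi> j \<noteq> face_at P \<Psi> j"
  shows "face_at P (adj_flag P j \<Psi>) j = face_at P \<Phi> j"
proof (rule card_2_third[OF card_between[OF \<Psi> j], where b = "face_at P \<Psi> j"])
  have "between \<Phi> j = between \<Psi> j" "between (adj_flag P j \<Psi>) j = between \<Psi> j"
    using assms face_at_adj_flag_off[OF \<Psi> j] by (simp_all add: between_def)
  then show "face_at P (adj_flag P j \<Psi>) j \<in> between \<Psi> j" "face_at P \<Phi> j \<in> between \<Psi> j"
    using face_at_between[OF \<Phi> j] face_at_between[OF adj_flag_in_flags[OF \<Psi> j] j] by simp_all
qed (use assms face_at_adj_flag_neq[OF \<Psi> j] face_at_between[OF \<Psi> j] in auto)

text \<open>The flags are compared rank by rank. Since i and j differ by at least two, changing one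
  face leaves the other face and both its neighbours in place, so the diamond used for the second
  change is the same in either order.\<close>

lemma adj_flag_commute:
  assumes \<Phi>: "\<Phi> \<in> flags P" and i: "0 \<le> i" "i < int n" and j: "0 \<le> j" "j < int n"
    and ij: "\<bar>i - j\<bar> \<ge> 2"
  shows "adj_flag P i (adj_flag P j \<Phi>) = adj_flag P j (adj_flag P i \<Phi>)"
proof (rule flag_eqI)
  note i\<Phi> = adj_flag_in_flags[OF \<Phi> i] and j\<Phi> = adj_flag_in_flags[OF \<Phi> j]
  show "adj_flag P i (adj_flag P j \<Phi>) \<in> flags P" "adj_flag P j (adj_flag P i \<Phi>) \<in> flags P"
    using adj_flag_in_flags i\<Phi> j\<Phi> i j by blast+
  fix k assume k: "-1 \<le> k" "k \<le> int n"
  have swap: "face_at P (adj_flag P a (adj_flag P b \<Phi>)) a = face_at P (adj_flag P a \<Phi>) a"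
    if a: "0 \<le> a" "a < int n" and b: "0 \<le> b" "b < int n" and "\<bar>a - b\<bar> \<ge> 2" for a b
    using that
    by (intro face_at_adj_flag_swap adj_flag_in_flags \<Phi>)
      (auto simp: face_at_adj_flag_off[OF \<Phi>] face_at_adj_flag_neq[OF \<Phi>])
  consider "k = i" | "k = j" | "k \<noteq> i" "k \<noteq> j" by blast
  then show "face_at P (adj_flag P i (adj_flag P j \<Phi>)) k = face_at P (adj_flag P j (adj_flag P i \<Phi>)) k"
  proof cases
    case 1
    then show ?thesis
      using swap[OF i j ij] face_at_adj_flag_off[OF i\<Phi> j, of i] i ij by auto
  next
    case 2
    then show ?thesis
      using swap[OF j i] face_at_adj_flag_off[OF j\<Phi> i, of j] j ij by auto
  next
    case 3
    then show ?thesis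
      using k by (simp add: face_at_adj_flag_off i j i\<Phi> j\<Phi> \<Phi>)
  qed
qed

lemma adjacent_adj_flag:
  assumes "\<Phi> \<in> flags P" "0 \<le> j" "j < int n"
  shows "adjacent \<Phi> (adj_flag P j \<Phi>)"
proof -
  have diff: "A - B = {face_at P A j}"
    if A: "A \<in> flags P" and B: "B \<in> flags P"
      and off: "{F \<in> A. rk F \<noteq> j} = {F \<in> B. rk F \<noteq> j}" and neq: "face_at P A j \<noteq> face_at P B j" for A B
  proof -
    have a: "face_at P A j \<in> A" "rk (face_at P A j) = j" using A assms face_at[of A j] by auto
    then have "face_at P A j \<notin> B" using face_at_eq[OF B] neq by metis
    moreover have "H = face_at P A j" if "H \<in> A - B" for H
    proof -
      have "rk H = j" using that off by blast
      then show ?thesis using face_at_eq[OF A, of H] that by auto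
    qed
    ultimately show ?thesis using a by blast
  qed
  show ?thesis
    unfolding adjacent_def
    using diff[of \<Phi> "adj_flag P j \<Phi>"] diff[of "adj_flag P j \<Phi>" \<Phi>] assms
      adj_flag_in_flags[OF assms] adj_flag_off[OF assms] face_at_adj_flag_neq[OF assms] by simp
qed

text \<open>Every rank occurs in both flags, so the two exchanged faces have the same rank. It is
  neither -1 nor n, because the least and the greatest face are the only ones of these
  ranks.\<close>

lemma adjacentD:
  assumes A: "A \<in> flags P" and B: "B \<in> flags P" and adj: "adjacent A B"
  shows "\<exists>j. 0 \<le> j \<and> j < int n \<and> B = adj_flag P j A"
proof -
  obtain F where F: "A - B = {F}" using adj by (auto simp: adjacent_def card_1_singleton_iff)
  obtain G where G: "B - A = {G}" using adj by (auto simp: adjacent_def card_1_singleton_iff)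
  have FG: "F \<in> A" "G \<in> B" "F \<notin> B" "G \<notin> A" using F G by auto
  have "rk F \<in> rk ` B" using flag_rk[OF A FG(1)] flag_rk_image[OF B] by auto
  then obtain H where H: "H \<in> B" "rk H = rk F" by auto
  have "H = G"
  proof (rule ccontr)
    assume "H \<noteq> G"
    then have "H \<in> A" using H G by auto
    then have "H = F" using flag_face_unique[OF A _ FG(1)] H by simp
    then show False using H FG by simp
  qed
  then have rk: "rk G = rk F" using H by simp
  have off: "{H \<in> B. rk H \<noteq> rk F} = {H \<in> A. rk H \<noteq> rk F}"
  proof -
    have "H \<in> A" if "H \<in> B" "H \<noteq> G" for H using G that by blast
    moreover have "H \<in> B" if "H \<in> A" "H \<noteq> F" for H using F that by blast
    ultimately show ?thesis using rk by blast
  qed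
  have "rk F \<noteq> -1"
  proof
    assume F1: "rk F = -1"
    obtain L where L: "L \<in> faces P" "rk L = -1" "\<And>H. H \<in> faces P \<Longrightarrow> (L, H) \<in> leq P"
      using polytope unfolding polytope_def by blast
    have "H = L" if "H \<in> faces P" "rk H = -1" for H
      using L(3)[OF that(1)] lt_rk[of L H] L(2) that by (auto simp: lt_def)
    then have "F = L" "G = L"
      using F1 rk FG flag_subset_faces[OF A] flag_subset_faces[OF B] by auto
    then show False using FG by simp
  qed
  moreover have "rk F \<noteq> int n"
  proof
    assume F1: "rk F = int n"
    obtain L where L: "L \<in> faces P" "rk L = int n" "\<And>H. H \<in> faces P \<Longrightarrow> (H, L) \<in> leq P"
      using polytope unfolding polytope_def by blast
    have "H = L" if "H \<in> faces P" "rk H = int n" for H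
      using L(3)[OF that(1)] lt_rk[of H L] L(2) that by (auto simp: lt_def)
    then have "F = L" "G = L"
      using F1 rk FG flag_subset_faces[OF A] flag_subset_faces[OF B] by auto
    then show False using FG by simp
  qed
  ultimately have j: "0 \<le> rk F" "rk F < int n" using flag_rk[OF A FG(1)] by auto
  moreover have "adj_flag P (rk F) A = B"
    using A B j off FG by (intro adj_flagI) auto
  ultimately show ?thesis by blast
qed

end

section \<open>Automorphisms\<close>

lemma aut_group_simps:
  "\<one>\<^bsub>aut_group P\<^esub> = (\<lambda>F \<in> faces P. F)"
  "\<gamma> \<otimes>\<^bsub>aut_group P\<^esub> \<phi> = compose (faces P) \<phi> \<gamma>"
  by (simp_all add: aut_group_def)

lemma aut_group_carrier_iff:
  "\<gamma> \<in> carrier (aut_group P) \<longleftrightarrow> \<gamma> \<in> Bij (faces P) \<and>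
     (\<forall>F \<in> faces P. \<forall>G \<in> faces P. (\<gamma> F, \<gamma> G) \<in> leq P \<longleftrightarrow> (F, G) \<in> leq P)"
  by (simp add: aut_group_def)

lemma aut_bij_betw: "\<gamma> \<in> carrier (aut_group P) \<Longrightarrow> bij_betw \<gamma> (faces P) (faces P)"
  by (simp add: aut_group_carrier_iff Bij_def)

lemma aut_face: "\<gamma> \<in> carrier (aut_group P) \<Longrightarrow> F \<in> faces P \<Longrightarrow> \<gamma> F \<in> faces P"
  using aut_bij_betw bij_betwE by blast

lemma aut_extensional: "\<gamma> \<in> carrier (aut_group P) \<Longrightarrow> \<gamma> \<in> extensional (faces P)"
  by (simp add: aut_group_carrier_iff Bij_def)

lemma group_aut_group: "group (aut_group P)"
proof (rule groupI)
  fix \<alpha> \<beta> \<gamma> assume \<alpha>: "\<alpha> \<in> carrier (aut_group P)"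
  note \<alpha>fun = funcsetI[OF aut_face[OF \<alpha>]]
  show "\<one>\<^bsub>aut_group P\<^esub> \<otimes>\<^bsub>aut_group P\<^esub> \<alpha> = \<alpha>"
    using compose_Id[OF \<alpha>fun aut_extensional[OF \<alpha>]] by (simp add: aut_group_simps)
  \<comment> \<open>The restriction makes the inverse extensional, as \<open>Bij\<close>
    demands.\<close>
  define \<alpha>' where "\<alpha>' = restrict (inv_into (faces P) \<alpha>) (faces P)"
  have inv: "\<alpha> (\<alpha>' F) = F" "\<alpha>' F \<in> faces P" if "F \<in> faces P" for F
    using that aut_bij_betw[OF \<alpha>]
    by (auto simp: \<alpha>'_def bij_betw_def f_inv_into_f inv_into_into)
  have "\<alpha>' \<in> Bij (faces P)"
    unfolding \<alpha>'_def using \<alpha> by (intro restrict_inv_into_Bij) (simp add: aut_group_carrier_iff)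
  moreover have "(\<alpha>' F, \<alpha>' G) \<in> leq P \<longleftrightarrow> (F, G) \<in> leq P" if "F \<in> faces P" "G \<in> faces P" for F G
    using that inv \<alpha> unfolding aut_group_carrier_iff by metis
  ultimately have "\<alpha>' \<in> carrier (aut_group P)" by (simp add: aut_group_carrier_iff)
  moreover have "\<alpha>' \<otimes>\<^bsub>aut_group P\<^esub> \<alpha> = \<one>\<^bsub>aut_group P\<^esub>"
    using inv by (auto simp: aut_group_simps compose_def)
  ultimately show "\<exists>\<beta>\<in>carrier (aut_group P). \<beta> \<otimes>\<^bsub>aut_group P\<^esub> \<alpha> = \<one>\<^bsub>aut_group P\<^esub>" by blast
  assume \<beta>: "\<beta> \<in> carrier (aut_group P)"
  show "\<alpha> \<otimes>\<^bsub>aut_group P\<^esub> \<beta> \<in> carrier (aut_group P)"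
    using \<alpha> \<beta> aut_face[OF \<alpha>] by (simp add: aut_group_simps aut_group_carrier_iff compose_Bij) (simp add: compose_def)
  assume "\<gamma> \<in> carrier (aut_group P)"
  show "\<alpha> \<otimes>\<^bsub>aut_group P\<^esub> \<beta> \<otimes>\<^bsub>aut_group P\<^esub> \<gamma> = \<alpha> \<otimes>\<^bsub>aut_group P\<^esub> (\<beta> \<otimes>\<^bsub>aut_group P\<^esub> \<gamma>)"
    using compose_assoc[OF \<alpha>fun] by (simp add: aut_group_simps)
next
  show "\<one>\<^bsub>aut_group P\<^esub> \<in> carrier (aut_group P)"
    by (simp add: aut_group_simps aut_group_carrier_iff id_Bij)
qed

lemma finite_aut_group:
  assumes "finite (faces P)"
  shows "finite (carrier (aut_group P))"
proof (rule finite_subset)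
  show "carrier (aut_group P) \<subseteq> faces P \<rightarrow>\<^sub>E faces P"
    using aut_face aut_extensional by (auto simp: PiE_def)
  show "finite (faces P \<rightarrow>\<^sub>E faces P)"
    using assms by (simp add: finite_PiE)
qed

lemma aut_mult_image:
  "\<Phi> \<subseteq> faces P \<Longrightarrow> (\<alpha> \<otimes>\<^bsub>aut_group P\<^esub> \<beta>) ` \<Phi> = \<beta> ` \<alpha> ` \<Phi>"
  by (auto simp: aut_group_simps compose_def image_iff subset_iff)

lemma aut_one_image: "\<Phi> \<subseteq> faces P \<Longrightarrow> \<one>\<^bsub>aut_group P\<^esub> ` \<Phi> = \<Phi>"
  by (auto simp: aut_group_simps image_iff subset_iff)

section \<open>The free action of automorphisms on flags\<close>

context finite_polytope
begin

lemma aut_leq: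
  "\<gamma> \<in> carrier (aut_group P) \<Longrightarrow> F \<in> faces P \<Longrightarrow> G \<in> faces P \<Longrightarrow>
     (\<gamma> F, \<gamma> G) \<in> leq P \<longleftrightarrow> (F, G) \<in> leq P"
  by (simp add: aut_group_carrier_iff)

lemma aut_inj: "\<gamma> \<in> carrier (aut_group P) \<Longrightarrow> inj_on \<gamma> (faces P)"
  using aut_bij_betw bij_betw_imp_inj_on by blast

lemma aut_flag:
  assumes \<gamma>: "\<gamma> \<in> carrier (aut_group P)" and \<Phi>: "\<Phi> \<in> flags P"
  shows "\<gamma> ` \<Phi> \<in> flags P"
proof (rule chain_flagI)
  note sub = flag_subset_faces[OF \<Phi>]
  show "\<gamma> ` \<Phi> \<in> Chains (leq P)"
    using flag_chain[OF \<Phi>] sub aut_leq[OF \<gamma>] unfolding Chains_def by blast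
  show "card (\<gamma> ` \<Phi>) = n + 2"
    using card_image[OF inj_on_subset[OF aut_inj[OF \<gamma>] sub]] card_flag[OF \<Phi>] by simp
qed

text \<open>Expresses the rank through the order, which is what automorphisms are required to
  preserve. The faces of a flag below \<open>F\<close> occupy the ranks from -1 to rk F - 1, and
  these are rk F + 1 values.\<close>

lemma rk_eq_card:
  assumes \<Phi>: "\<Phi> \<in> flags P" and F: "F \<in> \<Phi>"
  shows "rk F = int (card {H \<in> \<Phi>. lt P H F}) - 1"
proof -
  have "lt P H F \<longleftrightarrow> rk H < rk F" if "H \<in> \<Phi>" for H
    using lt_rk[of H F] flag_leq[OF \<Phi> that F] unfolding lt_def by force
  then have eq: "{H \<in> \<Phi>. lt P H F} = {H \<in> \<Phi>. rk H < rk F}" by auto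
  have "rk ` {H \<in> \<Phi>. rk H < rk F} = {-1..<rk F}"
  proof
    show "rk ` {H \<in> \<Phi>. rk H < rk F} \<subseteq> {-1..<rk F}"
      using flag_rk[OF \<Phi>] by auto
    show "{-1..<rk F} \<subseteq> rk ` {H \<in> \<Phi>. rk H < rk F}"
    proof
      fix k assume k: "k \<in> {-1..<rk F}"
      then have "k \<in> rk ` \<Phi>"
        using flag_rk[OF \<Phi> F] by (simp add: flag_rk_image[OF \<Phi>])
      with k show "k \<in> rk ` {H \<in> \<Phi>. rk H < rk F}" by auto
    qed
  qed
  moreover have "inj_on rk {H \<in> \<Phi>. rk H < rk F}"
    using chain_inj_rk[OF flag_chain[OF \<Phi>]] by (rule inj_on_subset) auto
  ultimately have "card {H \<in> \<Phi>. rk H < rk F} = card {-1..<rk F}"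
    using card_image by metis
  then show ?thesis
    using eq flag_rk[OF \<Phi> F] by simp
qed

text \<open>An automorphism maps the faces below \<open>F\<close> in a flag bijectively to those
  below its image in the image flag, and their number determines the rank.\<close>

lemma aut_rk:
  assumes \<gamma>: "\<gamma> \<in> carrier (aut_group P)" and F: "F \<in> faces P"
  shows "rk (\<gamma> F) = rk F"
proof -
  obtain \<Phi> where \<Phi>: "\<Phi> \<in> flags P" "F \<in> \<Phi>" using face_in_flag[OF F] by blast
  note sub = flag_subset_faces[OF \<Phi>(1)]
  have lt: "lt P (\<gamma> H) (\<gamma> F) \<longleftrightarrow> lt P H F" if "H \<in> \<Phi>" for H
    using that sub F aut_leq[OF \<gamma>] inj_onD[OF aut_inj[OF \<gamma>], of H F] unfolding lt_def by blast
  have "{H \<in> \<gamma> ` \<Phi>. lt P H (\<gamma> F)} = \<gamma> ` {H \<in> \<Phi>. lt P H F}"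
    using lt by blast
  moreover have "card (\<gamma> ` {H \<in> \<Phi>. lt P H F}) = card {H \<in> \<Phi>. lt P H F}"
    using sub by (intro card_image inj_on_subset[OF aut_inj[OF \<gamma>]]) auto
  ultimately show ?thesis
    using rk_eq_card[OF \<Phi>] rk_eq_card[OF aut_flag[OF \<gamma> \<Phi>(1)], of "\<gamma> F"] \<Phi>(2) by simp
qed

text \<open>As \<gamma> preserves ranks, the image flag has the property that characterises the
  adjacent flag uniquely.\<close>

lemma aut_adj_flag:
  assumes \<gamma>: "\<gamma> \<in> carrier (aut_group P)" and \<Phi>: "\<Phi> \<in> flags P" and j: "0 \<le> j" "j < int n"
  shows "\<gamma> ` adj_flag P j \<Phi> = adj_flag P j (\<gamma> ` \<Phi>)"
proof -
  note \<Psi> = adj_flag_in_flags[OF \<Phi> j]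
  note sub = flag_subset_faces[OF \<Phi>] flag_subset_faces[OF \<Psi>]
  have off: "{F \<in> \<gamma> ` A. rk F \<noteq> j} = \<gamma> ` {F \<in> A. rk F \<noteq> j}" if "A \<subseteq> faces P" for A
    using that aut_rk[OF \<gamma>] by auto
  have "adj_flag P j (\<gamma> ` \<Phi>) = \<gamma> ` adj_flag P j \<Phi>"
  proof (rule adj_flagI[OF aut_flag[OF \<gamma> \<Phi>] j aut_flag[OF \<gamma> \<Psi>]])
    show "\<gamma> ` adj_flag P j \<Phi> \<noteq> \<gamma> ` \<Phi>"
      using inj_on_image_eq_iff[OF aut_inj[OF \<gamma>] sub(2,1)] adj_flag_neq[OF \<Phi> j] by simp
    show "{F \<in> \<gamma> ` adj_flag P j \<Phi>. rk F \<noteq> j} = {F \<in> \<gamma> ` \<Phi>. rk F \<noteq> j}"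
      by (simp add: off sub adj_flag_off[OF \<Phi> j])
  qed
  then show ?thesis by simp
qed

text \<open>Strong flag-connectedness joins \<Phi> to every flag through adjacent ones, and being
  fixed passes along because automorphisms commute with \<open>adj_flag\<close>. A face is then
  fixed as the only one of its rank in a fixed flag.\<close>

lemma aut_eq_one:
  assumes \<gamma>: "\<gamma> \<in> carrier (aut_group P)" and \<Phi>: "\<Phi> \<in> flags P" and fixed: "\<gamma> ` \<Phi> = \<Phi>"
  shows "\<gamma> = \<one>\<^bsub>aut_group P\<^esub>"
proof -
  have all: "\<gamma> ` \<Psi> = \<Psi>" if \<Psi>: "\<Psi> \<in> flags P" for \<Psi>
  proof -
    have "(\<Phi>, \<Psi>) \<in> {(A, B). A \<in> flags P \<and> B \<in> flags P \<and> adjacent A B \<and>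
        \<Phi> \<inter> \<Psi> \<subseteq> A \<and> \<Phi> \<inter> \<Psi> \<subseteq> B}\<^sup>*"
      using polytope \<Phi> \<Psi> unfolding polytope_def strongly_flag_connected_def by blast
    then show ?thesis
    proof induction
      case base
      show ?case by (rule fixed)
    next
      case (step A B)
      then obtain j where j: "0 \<le> j" "j < int n" "B = adj_flag P j A" and "A \<in> flags P"
        using adjacentD[of A B] by blast
      then show ?case using step.IH aut_adj_flag[OF \<gamma>, of A j] by simp
    qed
  qed
  have "\<gamma> F = F" if F: "F \<in> faces P" for F
  proof -
    obtain \<Psi> where \<Psi>: "\<Psi> \<in> flags P" "F \<in> \<Psi>" using face_in_flag[OF F] by blast
    then have "\<gamma> F \<in> \<Psi>" using all[OF \<Psi>(1)] by blast
    then show ?thesis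
      using \<Psi> aut_rk[OF \<gamma> F] by (intro flag_face_unique[OF \<Psi>(1)]) auto
  qed
  then show ?thesis
    using aut_extensional[OF \<gamma>] by (intro extensionalityI[of _ "faces P"]) (auto simp: aut_group_simps)
qed

lemma aut_eqI:
  assumes \<alpha>: "\<alpha> \<in> carrier (aut_group P)" and \<beta>: "\<beta> \<in> carrier (aut_group P)"
    and \<Phi>: "\<Phi> \<in> flags P" and eq: "\<alpha> ` \<Phi> = \<beta> ` \<Phi>"
  shows "\<alpha> = \<beta>"
proof -
  interpret A: group "aut_group P" by (rule group_aut_group)
  note sub = flag_subset_faces[OF \<Phi>]
  have "(\<alpha> \<otimes>\<^bsub>aut_group P\<^esub> inv\<^bsub>aut_group P\<^esub> \<beta>) ` \<Phi> = (\<beta> \<otimes>\<^bsub>aut_group P\<^esub> inv\<^bsub>aut_group P\<^esub> \<beta>) ` \<Phi>"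
    unfolding aut_mult_image[OF sub] eq ..
  also have "\<dots> = \<Phi>"
    unfolding A.r_inv[OF \<beta>] by (rule aut_one_image[OF sub])
  finally have "\<alpha> \<otimes>\<^bsub>aut_group P\<^esub> inv\<^bsub>aut_group P\<^esub> \<beta> = \<one>\<^bsub>aut_group P\<^esub>"
    using A.m_closed[OF \<alpha> A.inv_closed[OF \<beta>]] \<Phi> by (intro aut_eq_one)
  then show ?thesis
    using A.inv_equality[of \<alpha> "inv\<^bsub>aut_group P\<^esub> \<beta>"] \<alpha> \<beta> A.inv_inv[OF \<beta>] A.inv_closed by metis
qed

end

section \<open>Rotations of a finite chiral polytope\<close>

locale finite_chiral_polytope =
  fixes n :: nat and P :: "'a rooted_poset"
  assumes chiral: "chiral_polytope n P" and finite_faces: "finite (faces P)"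

sublocale finite_chiral_polytope \<subseteq> finite_polytope n P
  using chiral finite_faces by unfold_locales (auto simp: chiral_polytope_def)

sublocale finite_chiral_polytope \<subseteq> Aut: group "aut_group P"
  by (rule group_aut_group)

context finite_chiral_polytope
begin

abbreviation "\<Gamma> \<equiv> aut_group P"

abbreviation "\<Phi> \<equiv> base_flag P"

abbreviation "adj \<equiv> adj_flag P"

lemma base_flag: "\<Phi> \<in> flags P"
  using polytope by (simp add: polytope_def)

text \<open>There are two orbits and adjacent flags lie in different ones, so two steps lead back to
  the orbit of \<Psi>.\<close>

lemma even_flag_in_orbit:
  assumes \<Psi>: "\<Psi> \<in> flags P" and i: "0 \<le> i" "i < int n" and j: "0 \<le> j" "j < int n"
  shows "\<exists>\<gamma> \<in> carrier \<Gamma>. \<gamma> ` \<Psi> = adj j (adj i \<Psi>)"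
proof -
  let ?o = "orbit \<Gamma> (`)"
  note \<Psi>i = adj_flag_in_flags[OF \<Psi> i]
  note \<Psi>ij = adj_flag_in_flags[OF \<Psi>i j]
  have "card (orbits \<Gamma> (flags P) (`)) = 2"
    using chiral by (simp add: chiral_polytope_def)
  moreover have "?o \<Psi> \<in> orbits \<Gamma> (flags P) (`)" "?o (adj i \<Psi>) \<in> orbits \<Gamma> (flags P) (`)"
      "?o (adj j (adj i \<Psi>)) \<in> orbits \<Gamma> (flags P) (`)"
    using \<Psi> \<Psi>i \<Psi>ij unfolding orbits_def by blast+
  moreover have "?o \<Psi> \<noteq> ?o (adj i \<Psi>)" "?o (adj j (adj i \<Psi>)) \<noteq> ?o (adj i \<Psi>)"
    using chiral \<Psi> \<Psi>i \<Psi>ij adjacent_adj_flag[OF \<Psi> i] adjacent_adj_flag[OF \<Psi>i j]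
    unfolding chiral_polytope_def by metis+
  ultimately have "?o \<Psi> = ?o (adj j (adj i \<Psi>))"
    by (rule card_2_third)
  moreover have "adj j (adj i \<Psi>) \<in> ?o (adj j (adj i \<Psi>))"
    using aut_one_image[OF flag_subset_faces[OF \<Psi>ij]] Aut.one_closed unfolding orbit_def by blast
  ultimately have "adj j (adj i \<Psi>) \<in> ?o \<Psi>" by simp
  then show ?thesis unfolding orbit_def mem_Collect_eq by metis
qed

text \<open>The description in \<open>sigma\<close> denotes: existence comes from
  \<open>even_flag_in_orbit\<close>, uniqueness from the freeness of the action.\<close>

lemma sigma:
  assumes "i \<in> {1..<n}"
  shows sigma_closed: "sigma P i \<in> carrier \<Gamma>"
    and sigma_base: "sigma P i ` \<Phi> = adj (int i - 1) (adj (int i) \<Phi>)"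
proof -
  have "\<exists>\<gamma> \<in> carrier \<Gamma>. \<gamma> ` \<Phi> = adj (int i - 1) (adj (int i) \<Phi>)"
    using assms by (intro even_flag_in_orbit base_flag) auto
  then have "\<exists>!\<gamma>. \<gamma> \<in> carrier \<Gamma> \<and> \<gamma> ` \<Phi> = adj (int i - 1) (adj (int i) \<Phi>)"
    using aut_eqI[OF _ _ base_flag] by metis
  from theI'[OF this] show "sigma P i \<in> carrier \<Gamma>"
    "sigma P i ` \<Phi> = adj (int i - 1) (adj (int i) \<Phi>)"
    unfolding sigma_def by blast+
qed

lemma inv_sigma_base:
  assumes i: "i \<in> {1..<n}"
  shows "(inv\<^bsub>\<Gamma>\<^esub> (sigma P i)) ` \<Phi> = adj (int i) (adj (int i - 1) \<Phi>)"
proof -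
  let ?s = "sigma P i" and ?\<Psi> = "adj (int i) (adj (int i - 1) \<Phi>)"
  have j: "0 \<le> int i - 1" "int i - 1 < int n" "0 \<le> int i" "int i < int n" using i by auto
  have \<Psi>: "?\<Psi> \<in> flags P" using j by (intro adj_flag_in_flags base_flag)
  \<comment> \<open>Moving the rotation inside the two changes and inserting its image of the base
    flag gives changes at ranks i, i - 1, i - 1, i, which cancel in pairs.\<close>
  have "?s ` ?\<Psi> = \<Phi>"
    using j by (simp add: aut_adj_flag[OF sigma_closed[OF i]] sigma_base[OF i] adj_flag_in_flags
        base_flag adj_flag_adj_flag)
  then have "(inv\<^bsub>\<Gamma>\<^esub> ?s) ` \<Phi> = (?s \<otimes>\<^bsub>\<Gamma>\<^esub> inv\<^bsub>\<Gamma>\<^esub> ?s) ` ?\<Psi>"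
    using aut_mult_image[OF flag_subset_faces[OF \<Psi>]] by metis
  then show ?thesis
    unfolding Aut.r_inv[OF sigma_closed[OF i]] aut_one_image[OF flag_subset_faces[OF \<Psi>]] .
qed

lemma sigma_in_funcset: "sigma P \<in> {1..<n} \<rightarrow> carrier \<Gamma>"
  using sigma_closed by blast

text \<open>Products act on the right, so the last factor is applied last. Commuting it past the
  changes already made brings two changes at rank j together; they cancel, and the product
  telescopes.\<close>

lemma eval_gen_word_base:
  assumes "1 \<le> i" "i \<le> j" "j < n"
  shows "eval_word \<Gamma> (sigma P) (gen_word i j) ` \<Phi> = adj (int i - 1) (adj (int j) \<Phi>)"
  using assms(2,3)
proof (induction j rule: dec_induct)
  case base
  then have "i \<in> {1..<n}" using assms by auto
  moreover have "eval_word \<Gamma> (sigma P) (gen_word i i) = sigma P i \<otimes>\<^bsub>\<Gamma>\<^esub> \<one>\<^bsub>\<Gamma>\<^esub>"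
    by (simp add: eval_word_Cons)
  ultimately show ?case
    using sigma[of i] by simp
next
  case (step j)
  have j: "Suc j \<in> {1..<n}" "j < n" using step assms by auto
  let ?E = "eval_word \<Gamma> (sigma P) (gen_word i j)" and ?s = "sigma P (Suc j)"
  have "gen_word i (Suc j) = gen_word i j @ [(Suc j, True)]"
    using step by simp
  then have "eval_word \<Gamma> (sigma P) (gen_word i (Suc j))
      = ?E \<otimes>\<^bsub>\<Gamma>\<^esub> eval_word \<Gamma> (sigma P) [(Suc j, True)]"
    using Aut.eval_word_append[OF sigma_in_funcset gen_word_words[OF assms(1) j(2)], of "[(Suc j, True)]"] j
    by (simp del: upt_Suc)
  also have "\<dots> = ?E \<otimes>\<^bsub>\<Gamma>\<^esub> ?s"
    using sigma_closed[OF j(1)] by (simp add: eval_word_Cons del: upt_Suc)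
  finally have "eval_word \<Gamma> (sigma P) (gen_word i (Suc j)) ` \<Phi> = ?s ` ?E ` \<Phi>"
    using aut_mult_image[OF flag_subset_faces[OF base_flag]] by metis
  also have "\<dots> = ?s ` adj (int i - 1) (adj (int j) \<Phi>)"
    using step.IH[OF j(2)] by simp
  also have "\<dots> = adj (int i - 1) (adj (int j) (?s ` \<Phi>))"
    using j assms(1) step.hyps
    by (simp add: aut_adj_flag[OF sigma_closed[OF j(1)]] adj_flag_in_flags base_flag)
  also have "?s ` \<Phi> = adj (int j) (adj (int (Suc j)) \<Phi>)"
    using sigma_base[OF j(1)] by simp
  also have "adj (int j) \<dots> = adj (int (Suc j)) \<Phi>"
    using j by (intro adj_flag_adj_flag adj_flag_in_flags base_flag) auto
  finally show ?case .
qed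

text \<open>The product from i to j changes the base flag at the ranks j and i - 1, which differ by
  at least two because i < j. The two changes commute, so the square of the product fixes the base
  flag and is one by freeness.\<close>

lemma Wplus_gens_sigma: "Wplus_gens n \<Gamma> (sigma P)"
  unfolding Aut.Wplus_gens_iff
proof (intro conjI allI impI sigma_in_funcset)
  fix i j :: nat assume ij: "1 \<le> i" "i < j" "j < n"
  let ?E = "eval_word \<Gamma> (sigma P) (gen_word i j)"
  have E: "?E \<in> carrier \<Gamma>"
    by (rule Aut.eval_word_closed[OF sigma_in_funcset gen_word_words[OF ij(1,3)]])
  have Eb: "?E ` \<Phi> = adj (int i - 1) (adj (int j) \<Phi>)"
    using ij by (intro eval_gen_word_base) auto
  have r: "0 \<le> int i - 1" "int i - 1 < int n" "0 \<le> int j" "int j < int n"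
    "\<bar>int j - (int i - 1)\<bar> \<ge> 2" using ij by auto
  note fl = adj_flag_in_flags base_flag
  have "(?E \<otimes>\<^bsub>\<Gamma>\<^esub> ?E) ` \<Phi> = ?E ` adj (int i - 1) (adj (int j) \<Phi>)"
    unfolding aut_mult_image[OF flag_subset_faces[OF base_flag]] Eb ..
  also have "\<dots> = adj (int i - 1) (adj (int j) (adj (int i - 1) (adj (int j) \<Phi>)))"
    using r by (simp add: aut_adj_flag[OF E] fl Eb del: upt_Suc)
  also have "adj (int j) (adj (int i - 1) (adj (int j) \<Phi>)) = adj (int i - 1) (adj (int j) (adj (int j) \<Phi>))"
    using r by (intro adj_flag_commute fl)
  also have "adj (int i - 1) \<dots> = \<Phi>"
    using r by (simp add: adj_flag_adj_flag fl)
  finally show "?E \<otimes>\<^bsub>\<Gamma>\<^esub> ?E = \<one>\<^bsub>\<Gamma>\<^esub>"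
    by (rule aut_eq_one[OF Aut.m_closed[OF E E] base_flag])
qed

text \<open>By freeness it suffices to compare images of the mirror's base flag
  \<open>adj 0 \<Phi>\<close>. Automorphisms commute with \<open>adj 0\<close>, so these follow from
  the images of \<Phi>.\<close>

lemma sigma_mirror_image:
  assumes i: "i \<in> {1..<n}"
  shows "sigma (mirror_image P) i = bar_gens \<Gamma> (sigma P) i"
proof -
  let ?\<Psi> = "adj 0 \<Phi>"
  have n: "0 < int n" using i by auto
  have \<Psi>: "?\<Psi> \<in> flags P" using n by (intro adj_flag_in_flags base_flag) auto
  have closed: "bar_gens \<Gamma> (sigma P) i \<in> carrier \<Gamma>"
    using Aut.bar_gens_closed[OF sigma_in_funcset] i by blast
  note fl = adj_flag_in_flags base_flag
  have image: "bar_gens \<Gamma> (sigma P) i ` ?\<Psi> = adj (int i - 1) (adj (int i) ?\<Psi>)"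
  proof -
    have s1: "1 \<in> {1..<n}" using i by auto
    consider "i = 1" | "i = 2" | "3 \<le> i" using i by (auto, linarith)
    then have "adj 0 (bar_gens \<Gamma> (sigma P) i ` \<Phi>) = adj (int i - 1) (adj (int i) ?\<Psi>)"
    proof cases
      case 1
      then show ?thesis using inv_sigma_base[OF s1] by (simp add: bar_gens_def)
    next
      case 2
      let ?a = "sigma P 1" and ?b = "sigma P 2"
      have s2: "2 \<in> {1..<n}" using i 2 by simp
      have r: "1 < int n" "2 < int n" using s2 by auto
      have "bar_gens \<Gamma> (sigma P) i = (?a \<otimes>\<^bsub>\<Gamma>\<^esub> ?a) \<otimes>\<^bsub>\<Gamma>\<^esub> ?b"
        using 2 sigma_closed[OF s1] by (simp add: bar_gens_def eval_nat_numeral)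
      \<comment> \<open>The factors act from left to right, and each passes inside the changes made
        before it. The two neighbouring changes at rank 1 cancel, and those at ranks 0 and 2
        commute.\<close>
      then have "bar_gens \<Gamma> (sigma P) i ` \<Phi> = ?b ` ?a ` ?a ` \<Phi>"
        using aut_mult_image[OF flag_subset_faces[OF base_flag]] by metis
      also have "?a ` \<Phi> = adj 0 (adj 1 \<Phi>)"
        using sigma_base[OF s1] by simp
      also have "?a ` \<dots> = adj 0 (adj 1 (adj 0 (adj 1 \<Phi>)))"
        using r sigma_base[OF s1] by (simp add: aut_adj_flag[OF sigma_closed[OF s1]] fl del: One_nat_def)
      also have "?b ` \<dots> = adj 0 (adj 1 (adj 0 (adj 1 (adj 1 (adj 2 \<Phi>)))))"
        using r sigma_base[OF s2] by (simp add: aut_adj_flag[OF sigma_closed[OF s2]] fl)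
      also have "\<dots> = adj 0 (adj 1 (adj 0 (adj 2 \<Phi>)))"
        using r by (simp add: adj_flag_adj_flag fl)
      also have "adj 0 (adj 2 \<Phi>) = adj 2 (adj 0 \<Phi>)"
        using r by (intro adj_flag_commute base_flag) auto
      finally show ?thesis
        using r 2 by (simp add: adj_flag_adj_flag fl)
    next
      case 3
      \<comment> \<open>From i = 3 on, rank 0 is at distance at least two from both i - 1 and i, so
        \<open>adj 0\<close> commutes with both changes.\<close>
      then have r: "0 \<le> int i - 1" "int i - 1 < int n" "0 \<le> int i" "int i < int n"
        "\<bar>0 - (int i - 1)\<bar> \<ge> 2" "\<bar>0 - int i\<bar> \<ge> 2" using i by auto
      have "adj 0 (bar_gens \<Gamma> (sigma P) i ` \<Phi>) = adj 0 (adj (int i - 1) (adj (int i) \<Phi>))"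
        using 3 sigma_base[OF i] by (simp add: bar_gens_def)
      also have "\<dots> = adj (int i - 1) (adj 0 (adj (int i) \<Phi>))"
        using r n by (intro adj_flag_commute fl) auto
      also have "adj 0 (adj (int i) \<Phi>) = adj (int i) ?\<Psi>"
        using r n by (intro adj_flag_commute fl) auto
      finally show ?thesis .
    qed
    then show ?thesis
      using aut_adj_flag[OF closed base_flag, of 0] n by simp
  qed
  have base: "base_flag (mirror_image P) = ?\<Psi>" by (simp add: mirror_image_def)
  show ?thesis
    unfolding sigma_def[of "mirror_image P"] base
  proof (rule the_equality)
    fix \<gamma> assume "\<gamma> \<in> carrier (aut_group (mirror_image P)) \<and> \<gamma> ` ?\<Psi>
        = adj_flag (mirror_image P) (int i - 1) (adj_flag (mirror_image P) (int i) ?\<Psi>)"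
    then show "\<gamma> = bar_gens \<Gamma> (sigma P) i"
      using image by (intro aut_eqI[OF _ closed \<Psi>]) simp_all
  qed (use closed image in simp)
qed

text \<open>Rank k of the dual is rank n - 1 - k of \<open>P\<close>, so the ranks i and i - 1
  become (n - i) - 1 and n - i. Changing the base flag at these two in this order is the effect of
  the inverse of the rotation with index n - i.\<close>

lemma sigma_dual_polytope:
  assumes i: "i \<in> {1..<n}"
  shows "sigma (dual_polytope n P) i = inv\<^bsub>\<Gamma>\<^esub> (sigma P (n - i))"
proof -
  have ni: "n - i \<in> {1..<n}" using i by auto
  have closed: "inv\<^bsub>\<Gamma>\<^esub> (sigma P (n - i)) \<in> carrier \<Gamma>"
    using sigma_closed[OF ni] by (rule Aut.inv_closed)
  have base: "base_flag (dual_polytope n P) = \<Phi>" by (simp add: dual_polytope_def)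
  have "int n - 1 - (int i - 1) = int (n - i)" "int n - 1 - int i = int (n - i) - 1"
    using i by auto
  then have image: "(inv\<^bsub>\<Gamma>\<^esub> (sigma P (n - i))) ` \<Phi>
      = adj_flag (dual_polytope n P) (int i - 1) (adj_flag (dual_polytope n P) (int i) \<Phi>)"
    using inv_sigma_base[OF ni] by (simp only: adj_flag_dual_polytope)
  show ?thesis
    unfolding sigma_def[of "dual_polytope n P"] base
  proof (rule the_equality)
    fix \<gamma> assume "\<gamma> \<in> carrier (aut_group (dual_polytope n P)) \<and> \<gamma> ` \<Phi>
        = adj_flag (dual_polytope n P) (int i - 1) (adj_flag (dual_polytope n P) (int i) \<Phi>)"
    then show "\<gamma> = inv\<^bsub>\<Gamma>\<^esub> (sigma P (n - i))"
      using image by (intro aut_eqI[OF _ closed base_flag]) simp_all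
  qed (use closed image in simp)
qed

end

theorem theorem5p3:
  fixes P :: "'a rooted_poset" and n :: nat and p li :: "nat \<Rightarrow> nat" and l :: nat
  assumes "chiral_polytope n P"
    and "finite (faces P)"
    and "has_type n P p"
    and "\<And>i. i \<in> {1..<n} \<Longrightarrow> li i = lcm (p i) (p (n - i))"
    and "l = Lcm ((\<lambda>i. li i div p i) ` {1..<n})"
    and "order (comix {1..<n} (rotation_group P) (rotation_group (mirror_image P)))
         < l * order (comix {1..<n} (rotation_group P) (rotation_group (dual_polytope n P)))"
  shows "mix_chiral n P (dual_polytope n P)"
proof (rule ccontr)
  interpret finite_chiral_polytope n P
    using assms(1,2) by unfold_locales
  assume "\<not> mix_chiral n P (dual_polytope n P)"
  then have "Wplus_bar n ` Wplus_kernel n (mix {1..<n} (\<Gamma>, sigma P) (\<Gamma>, sigma (dual_polytope n P)))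
      \<subseteq> Wplus_kernel n (mix {1..<n} (\<Gamma>, sigma P) (\<Gamma>, sigma (dual_polytope n P)))"
    by (simp add: mix_chiral_def rotation_group_def Let_def)
  \<comment> \<open>The bound for one finite group applies because the mirror image and the dual
    have the same automorphism group as \<open>P\<close>; their rotations are the barred and the
    dual tuple.\<close>
  then have "Lcm ((\<lambda>i. lcm (p i) (p (n - i)) div p i) ` {1..<n})
        * order (comix {1..<n} (\<Gamma>, sigma P) (\<Gamma>, sigma (dual_polytope n P)))
      \<le> order (comix {1..<n} (\<Gamma>, sigma P) (\<Gamma>, sigma (mirror_image P)))"
    using assms(3) by (intro comix_order_bound group_aut_group finite_aut_group finite_faces
        Wplus_gens_sigma sigma_mirror_image sigma_dual_polytope) (auto simp: has_type_def)
  moreover have "l = Lcm ((\<lambda>i. lcm (p i) (p (n - i)) div p i) ` {1..<n})"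
    using assms(4,5) by simp
  ultimately show False
    using assms(6) by (simp add: rotation_group_def)
qed

end
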